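(* Let $\beta\in(0,1)$, and let $\eta>0$, $\kappa>0$ and $\gamma>\eta^2$. Then the closed-loop system $\dot x(t)=Tx(t)$, $x(0)=x_0$, with the operator $T$ in $\mathbb{X}$ defined in the context, is exponentially stable; i.e. there exist constants $\varepsilon>0$ and $M\ge1$ such that the $C_0$-semigroup $\mathcal{U}(t)$ generated by $T$ satisfies $\|\mathcal{U}(t)\|\le Me^{-\varepsilon t}$ for all $t\ge0$.
   Context: The closed-loop system is the abstract form of the initial/boundary-value problem $$\partial_s^4w-(\gamma-\eta^2)\partial_s^2w+2\beta\eta\,\partial_s\partial_tw+\partial_t^2w=0,\quad s\in(0,1),\ t>0,$$ $w(0,t)=\partial_s^2w(0,t)=0$, $\partial_s^2w(1,t)=-\kappa\,\partial_s\partial_tw(1,t)$, $\partial_s^3w(1,t)=(\gamma-\eta^2)\partial_sw(1,t)$, with $x(t)=(w(\cdot,t),\partial_tw(\cdot,t))$. State space: $\mathbb{X}=\mathring H^2(0,1)\times L_2(0,1)$ (complex-valued functions), $\mathring H^2(0,1)=\{w\in H^2(0,1):w(0)=0\}$, with inner product, for $x=(w,v)$, $\tilde x=(\tilde w,\tilde v)$, $$\langle x,\tilde x\rangle=\int_0^1\big[w''\overline{\tilde w''}+(\gamma-\eta^2)w'\overline{\tilde w'}+v\overline{\tilde v}\big]ds,\qquad \|x\|=\langle x,x\rangle^{1/2}.$$ Operator: $$T\begin{pmatrix}w\\ v\end{pmatrix}=\begin{pmatrix}v\\ -w^{(4)}+(\gamma-\eta^2)w''-2\beta\eta v'\end{pmatrix},$$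 with $D(T)$ the set of $(w,v)\in\mathbb{X}$ with $w\in H^4(0,1)\cap\mathring H^2(0,1)$, $v\in\mathring H^2(0,1)$, $w''(0)=0$, $w''(1)+\kappa v'(1)=0$, $w^{(3)}(1)-(\gamma-\eta^2)w'(1)=0$. $T$ generates a contraction $C_0$-semigroup $\mathcal{U}(t)$ on $\mathbb{X}$. *)

theory Defs
  imports "HOL-Analysis.Analysis"
begin

abbreviation unit_interval :: "real measure" where
  "unit_interval \<equiv> lebesgue_on {0<..<1}"

definition square_integrable :: "(real \<Rightarrow> complex) \<Rightarrow> bool" where
  "square_integrable f \<longleftrightarrow>
     f \<in> borel_measurable unit_interval \<and> integrable unit_interval (\<lambda>s. (cmod (f s))\<^sup>2)"

definition eq_L2 :: "(real \<Rightarrow> complex) \<Rightarrow> (real \<Rightarrow> complex) \<Rightarrow> bool" where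
  "eq_L2 f g \<longleftrightarrow>
     square_integrable f \<and> square_integrable g \<and> (AE s in unit_interval. f s = g s)"

lemma AE_eq_cong:
  assumes "AE s in M. f s = f' s"
  shows "(AE s in M. f s = h s) \<longleftrightarrow> (AE s in M. f' s = h s)"
  using assms by (intro iffI; auto elim: AE_mp)

lemma square_integrable_zero: "square_integrable (\<lambda>s. 0)"
  by (simp add: square_integrable_def)

lemma square_integrable_add:
  assumes "square_integrable f" "square_integrable g"
  shows "square_integrable (\<lambda>s. f s + g s)"
proof -
  have [measurable]: "f \<in> borel_measurable unit_interval" "g \<in> borel_measurable unit_interval"
    using assms by (auto simp: square_integrable_def)
  have bound: "(cmod (a + b))\<^sup>2 \<le> 2 * (cmod a)\<^sup>2 + 2 * (cmod b)\<^sup>2" for a b :: complex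
  proof -
    have "(cmod (a + b))\<^sup>2 \<le> (cmod a + cmod b)\<^sup>2"
      by (intro power_mono norm_triangle_ineq) simp
    also have "\<dots> \<le> 2 * (cmod a)\<^sup>2 + 2 * (cmod b)\<^sup>2"
      using sum_squares_bound[of "cmod a" "cmod b"] by (simp add: power2_sum)
    finally show ?thesis .
  qed
  have "integrable unit_interval (\<lambda>s. 2 * (cmod (f s))\<^sup>2 + 2 * (cmod (g s))\<^sup>2)"
    using assms by (auto simp: square_integrable_def)
  then have "integrable unit_interval (\<lambda>s. (cmod (f s + g s))\<^sup>2)"
    by (rule Bochner_Integration.integrable_bound) (use bound in \<open>auto intro!: AE_I2\<close>)
  then show ?thesis
    by (simp add: square_integrable_def)
qed

lemma square_integrable_mult:
  "square_integrable f \<Longrightarrow> square_integrable (\<lambda>s. c * f s)"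
  by (auto simp: square_integrable_def norm_mult power_mult_distrib)

lemma square_integrable_uminus:
  "square_integrable f \<Longrightarrow> square_integrable (\<lambda>s. - f s)"
  by (auto simp: square_integrable_def)

lemma square_integrable_diff:
  "square_integrable f \<Longrightarrow> square_integrable g \<Longrightarrow> square_integrable (\<lambda>s. f s - g s)"
  using square_integrable_add[OF _ square_integrable_uminus, of f g] by simp

quotient_type L2 = "real \<Rightarrow> complex" / partial: eq_L2
proof (rule part_equivpI)
  show "\<exists>f. eq_L2 f f"
    using square_integrable_zero by (auto simp: eq_L2_def)
  show "symp eq_L2"
    by (auto simp: symp_def eq_L2_def elim!: AE_mp)
  show "transp eq_L2"
    by (auto simp: transp_def eq_L2_def elim!: AE_mp)
qed

instantiation L2 :: ab_group_add
begin

lift_definition zero_L2 :: L2 is "\<lambda>s. 0"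
  by (simp add: eq_L2_def square_integrable_zero)

lift_definition plus_L2 :: "L2 \<Rightarrow> L2 \<Rightarrow> L2" is "\<lambda>f g s. f s + g s"
  by (auto simp: eq_L2_def square_integrable_add elim!: AE_mp)

lift_definition minus_L2 :: "L2 \<Rightarrow> L2 \<Rightarrow> L2" is "\<lambda>f g s. f s - g s"
  by (auto simp: eq_L2_def square_integrable_diff elim!: AE_mp)

lift_definition uminus_L2 :: "L2 \<Rightarrow> L2" is "\<lambda>f s. - f s"
  by (auto simp: eq_L2_def square_integrable_uminus elim!: AE_mp)

instance
proof
  fix a b c :: L2
  show "a + b + c = a + (b + c)"
    by transfer (auto simp: eq_L2_def algebra_simps square_integrable_add)
  show "a + b = b + a"
    by transfer (auto simp: eq_L2_def algebra_simps square_integrable_add)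
  show "0 + a = a"
    by transfer (auto simp: eq_L2_def)
  show "- a + a = 0"
    by transfer (auto simp: eq_L2_def square_integrable_zero)
  show "a - b = a + - b"
    by transfer (auto simp: eq_L2_def square_integrable_diff)
qed

end

lift_definition scale_L2 :: "complex \<Rightarrow> L2 \<Rightarrow> L2" is "\<lambda>c f s. c * f s"
  by (auto simp: eq_L2_def square_integrable_mult elim!: AE_mp)

lift_definition inner_L2 :: "L2 \<Rightarrow> L2 \<Rightarrow> complex" is
  "\<lambda>f g. LINT s|unit_interval. f s * cnj (g s)"
proof -
  fix f f' g g' assume *: "eq_L2 f f'" "eq_L2 g g'"
  then have [measurable]: "f \<in> borel_measurable unit_interval" "f' \<in> borel_measurable unit_interval"
      "g \<in> borel_measurable unit_interval" "g' \<in> borel_measurable unit_interval"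
    by (auto simp: eq_L2_def square_integrable_def)
  have cnj: "cnj \<in> borel_measurable borel"
    by (intro borel_measurable_continuous_onI continuous_intros)
  have "AE s in unit_interval. f s = f' s" "AE s in unit_interval. g s = g' s"
    using * by (auto simp: eq_L2_def)
  then have "AE s in unit_interval. f s * cnj (g s) = f' s * cnj (g' s)"
    by eventually_elim simp
  then show "(LINT s|unit_interval. f s * cnj (g s)) = (LINT s|unit_interval. f' s * cnj (g' s))"
    by (intro integral_cong_AE borel_measurable_times measurable_compose[OF _ cnj]) auto
qed

text \<open>
  In one dimension, an element \<open>f\<close> of $L_2(0,1)$ has the weak derivative \<open>g\<close> in $L_2(0,1)$ when
  it has an absolutely continuous representative whose almost everywhere derivative is \<open>g\<close>,
  that is, when \<open>f\<close> is up to a constant the indefinite integral of \<open>g\<close>.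
\<close>

lift_definition has_weak_deriv :: "L2 \<Rightarrow> L2 \<Rightarrow> bool" is
  "\<lambda>f g. \<exists>c. AE s in unit_interval. f s = c + (LINT r:{0<..<s}|unit_interval. g r)"
proof -
  fix f f' g g' assume *: "eq_L2 f f'" "eq_L2 g g'"
  then have [measurable]: "g \<in> borel_measurable unit_interval" "g' \<in> borel_measurable unit_interval"
    by (auto simp: eq_L2_def square_integrable_def)
  have int: "(LINT r:{0<..<s}|unit_interval. g r) = (LINT r:{0<..<s}|unit_interval. g' r)" for s
    unfolding set_lebesgue_integral_def
  proof (rule integral_cong_AE)
    have [measurable]: "indicat_real {0<..<s} \<in> borel_measurable unit_interval"
      by (intro measurable_restrict_space1 borel_measurable_indicator) simp
    show "(\<lambda>r. indicat_real {0<..<s} r *\<^sub>R g r) \<in> borel_measurable unit_interval"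
      "(\<lambda>r. indicat_real {0<..<s} r *\<^sub>R g' r) \<in> borel_measurable unit_interval"
      by measurable
    show "AE r in unit_interval. indicat_real {0<..<s} r *\<^sub>R g r = indicat_real {0<..<s} r *\<^sub>R g' r"
      using * by (auto simp: eq_L2_def elim!: AE_mp)
  qed
  have "AE s in unit_interval. f s = f' s"
    using * by (simp add: eq_L2_def)
  then have "(AE s in unit_interval. f s = h s) \<longleftrightarrow> (AE s in unit_interval. f' s = h s)" for h
    by (rule AE_eq_cong)
  then show "(\<exists>c. AE s in unit_interval. f s = c + (LINT r:{0<..<s}|unit_interval. g r)) \<longleftrightarrow>
        (\<exists>c. AE s in unit_interval. f' s = c + (LINT r:{0<..<s}|unit_interval. g' r))"
    by (simp add: int)
qed

text \<open>The weak derivative is unique; \<open>weak_deriv f\<close> is meaningful only for \<open>f\<close> in $H^1(0,1)$.\<close>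

definition weak_deriv :: "L2 \<Rightarrow> L2" where
  "weak_deriv f = (THE g. has_weak_deriv f g)"

abbreviation weak_deriv_iter :: "nat \<Rightarrow> L2 \<Rightarrow> L2" where
  "weak_deriv_iter k \<equiv> weak_deriv ^^ k"

primrec sobolev :: "nat \<Rightarrow> L2 set" where
  "sobolev 0 = UNIV"
| "sobolev (Suc k) = {f. \<exists>g. has_weak_deriv f g \<and> g \<in> sobolev k}"

text \<open>
  The value at \<open>a\<close> in $[0,1]$ of the continuous representative; meaningful for elements
  of $H^1(0,1)$, all of which have exactly one continuous representative on $[0,1]$.
\<close>

lift_definition value_at :: "L2 \<Rightarrow> real \<Rightarrow> complex" is
  "\<lambda>f a. THE y. \<exists>F. continuous_on {0..1} F \<and> (AE s in unit_interval. f s = F s) \<and> F a = y"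
proof -
  fix f f' assume "eq_L2 f f'"
  then have "AE s in unit_interval. f s = f' s"
    by (simp add: eq_L2_def)
  then have "(AE s in unit_interval. f s = F s) \<longleftrightarrow> (AE s in unit_interval. f' s = F s)" for F
    by (rule AE_eq_cong)
  then show "(\<lambda>a. THE y. \<exists>F. continuous_on {0..1} F \<and> (AE s in unit_interval. f s = F s) \<and> F a = y)
      = (\<lambda>a. THE y. \<exists>F. continuous_on {0..1} F \<and> (AE s in unit_interval. f' s = F s) \<and> F a = y)"
    by simp
qed

definition sobolev2_0 :: "L2 set" where
  "sobolev2_0 = {w \<in> sobolev 2. value_at w 0 = 0}"

text \<open>
  The complex normed space is given by a carrier \<open>X\<close>, a scalar multiplication \<open>smul\<close> and a
  norm \<open>N\<close>, since the norm of the state space depends on the parameters of the problem.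
  Operators on \<open>X\<close> are functions of which only the values on \<open>X\<close> matter.
\<close>

definition bounded_operator ::
  "'a::ab_group_add set \<Rightarrow> (complex \<Rightarrow> 'a \<Rightarrow> 'a) \<Rightarrow> ('a \<Rightarrow> real) \<Rightarrow> ('a \<Rightarrow> 'a) \<Rightarrow> bool" where
  "bounded_operator X smul N A \<longleftrightarrow>
     (\<forall>x\<in>X. A x \<in> X) \<and>
     (\<forall>x\<in>X. \<forall>y\<in>X. A (x + y) = A x + A y) \<and>
     (\<forall>c. \<forall>x\<in>X. A (smul c x) = smul c (A x)) \<and>
     (\<exists>K. \<forall>x\<in>X. N (A x) \<le> K * N x)"

definition operator_norm :: "'a set \<Rightarrow> ('a \<Rightarrow> real) \<Rightarrow> ('a \<Rightarrow> 'a) \<Rightarrow> real" where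
  "operator_norm X N A = (SUP x\<in>{x \<in> X. N x \<le> 1}. N (A x))"

definition C0_semigroup ::
  "'a::ab_group_add set \<Rightarrow> (complex \<Rightarrow> 'a \<Rightarrow> 'a) \<Rightarrow> ('a \<Rightarrow> real) \<Rightarrow> (real \<Rightarrow> 'a \<Rightarrow> 'a) \<Rightarrow> bool" where
  "C0_semigroup X smul N U \<longleftrightarrow>
     (\<forall>t\<ge>0. bounded_operator X smul N (U t)) \<and>
     (\<forall>x\<in>X. U 0 x = x) \<and>
     (\<forall>s\<ge>0. \<forall>t\<ge>0. \<forall>x\<in>X. U (s + t) x = U s (U t x)) \<and>
     (\<forall>x\<in>X. ((\<lambda>t. N (U t x - x)) \<longlongrightarrow> 0) (at_right 0))"

definition generator_graph ::
  "'a::ab_group_add set \<Rightarrow> (complex \<Rightarrow> 'a \<Rightarrow> 'a) \<Rightarrow> ('a \<Rightarrow> real) \<Rightarrow> (real \<Rightarrow> 'a \<Rightarrow> 'a) \<Rightarrow> ('a \<times> 'a) set" where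
  "generator_graph X smul N U =
     {(x, y). x \<in> X \<and> y \<in> X \<and>
        ((\<lambda>h. N (smul (of_real (1 / h)) (U h x - x) - y)) \<longlongrightarrow> 0) (at_right 0)}"

definition generates ::
  "'a::ab_group_add set \<Rightarrow> (complex \<Rightarrow> 'a \<Rightarrow> 'a) \<Rightarrow> ('a \<Rightarrow> real) \<Rightarrow>
   'a set \<Rightarrow> ('a \<Rightarrow> 'a) \<Rightarrow> (real \<Rightarrow> 'a \<Rightarrow> 'a) \<Rightarrow> bool" where
  "generates X smul N D A U \<longleftrightarrow>
     C0_semigroup X smul N U \<and> generator_graph X smul N U = {(x, A x) | x. x \<in> D}"

definition state_space :: "(L2 \<times> L2) set" where
  "state_space = sobolev2_0 \<times> UNIV"

definition scale_state :: "complex \<Rightarrow> L2 \<times> L2 \<Rightarrow> L2 \<times> L2" where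
  "scale_state c = (\<lambda>(w, v). (scale_L2 c w, scale_L2 c v))"

definition inner_state :: "real \<Rightarrow> real \<Rightarrow> L2 \<times> L2 \<Rightarrow> L2 \<times> L2 \<Rightarrow> complex" where
  "inner_state \<gamma> \<eta> = (\<lambda>(w, v) (w', v').
     inner_L2 (weak_deriv_iter 2 w) (weak_deriv_iter 2 w')
     + of_real (\<gamma> - \<eta>\<^sup>2) * inner_L2 (weak_deriv w) (weak_deriv w')
     + inner_L2 v v')"

definition norm_state :: "real \<Rightarrow> real \<Rightarrow> L2 \<times> L2 \<Rightarrow> real" where
  "norm_state \<gamma> \<eta> x = sqrt (Re (inner_state \<gamma> \<eta> x x))"

definition op_T :: "real \<Rightarrow> real \<Rightarrow> real \<Rightarrow> L2 \<times> L2 \<Rightarrow> L2 \<times> L2" where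
  "op_T \<beta> \<gamma> \<eta> = (\<lambda>(w, v).
     (v, - weak_deriv_iter 4 w + scale_L2 (of_real (\<gamma> - \<eta>\<^sup>2)) (weak_deriv_iter 2 w)
         - scale_L2 (of_real (2 * \<beta> * \<eta>)) (weak_deriv v)))"

definition dom_T :: "real \<Rightarrow> real \<Rightarrow> real \<Rightarrow> (L2 \<times> L2) set" where
  "dom_T \<gamma> \<eta> \<kappa> = {(w, v) \<in> state_space.
     w \<in> sobolev 4 \<inter> sobolev2_0 \<and> v \<in> sobolev2_0 \<and>
     value_at (weak_deriv_iter 2 w) 0 = 0 \<and>
     value_at (weak_deriv_iter 2 w) 1 + of_real \<kappa> * value_at (weak_deriv v) 1 = 0 \<and>
     value_at (weak_deriv_iter 3 w) 1 - of_real (\<gamma> - \<eta>\<^sup>2) * value_at (weak_deriv w) 1 = 0}"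

end

theory Submission
  imports Defs
begin

text \<open>
  Along a solution the squared norm decreases at the rate $2\kappa|v'(1)|^2 + 2\beta\eta|v(1)|^2$,
  and it is perturbed to a strict Lyapunov functional by a small multiple of
  $\mathrm{Re}\int_0^1 (s\, v\overline{w'} + \beta\eta\, s|w'|^2)\,ds$. The first summand is the
  classical multiplier; the second one turns the gyroscopic term, which is not bounded by the
  energy, into an exact time derivative. The derivative of the perturbation is at most half the
  negative squared norm plus multiples of the two boundary terms that the dissipation controls.
  The resulting estimate on the domain of the generator extends by density.
\<close>

section \<open>The Hilbert space \<open>L2\<close> and primitives\<close>

text \<open>The obstacle is that nothing damps the slope w'(1): the dissipation sees only v'(1) and
  v(1). The multiplier identity helps itself here, since it produces |w'(1)|^2 with a negative
  coefficient, and exactly this amount absorbs the mixed boundary term w''(1) w'(1). What remains is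
  |w''(1)|^2, which the boundary condition turns into a multiple of |v'(1)|^2. The weight s vanishes
  at 0, so that no boundary terms arise there, and is at most 1, so that the perturbation is bounded
  by the energy. With a = \<gamma> - \<eta>^2, the computation takes place on triples (w'', sqrt a
  w', v), where the energy norm is the Hilbert norm of three copies of L2. No spectral information
  enters, and the constants are explicit: M = sqrt 3 and \<epsilon> = \<delta> / 6 for a
  perturbation of size \<delta>. The generator supplies only right derivatives of orbits, so
  monotonicity of the functional is derived from these together with continuity. Density of the
  domain is proved by hand, with polynomials that meet all the boundary conditions.\<close>

lemma eq_L2_refl [simp]: "eq_L2 f f \<longleftrightarrow> square_integrable f"
  by (simp add: eq_L2_def)

lemma L2_cases:
  obtains f where "square_integrable f" "x = abs_L2 f"
proof (rule that)
  show "square_integrable (rep_L2 x)"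
    using Quotient_rep_reflp[OF Quotient_L2, of x] by simp
  show "x = abs_L2 (rep_L2 x)"
    using Quotient_abs_rep[OF Quotient_L2, of x] by simp
qed

lemma abs_L2_eq_iff:
  assumes "square_integrable f" "square_integrable g"
  shows "abs_L2 f = abs_L2 g \<longleftrightarrow> (AE s in unit_interval. f s = g s)"
  using Quotient_rel[OF Quotient_L2, of f g] assms by (auto simp: eq_L2_def)

lemmas abs_L2_simps = plus_L2.abs_eq minus_L2.abs_eq uminus_L2.abs_eq scale_L2.abs_eq inner_L2.abs_eq
  zero_L2.abs_eq

interpretation unit_interval: finite_measure unit_interval
  by (intro finite_measure_lebesgue_on) simp

lemma measure_unit_interval [simp]: "measure unit_interval {0<..<1} = 1"
  by (simp add: measure_restrict_space)

lemma borel_measurable_cnj [measurable (raw)]: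
  assumes "f \<in> borel_measurable M"
  shows "(\<lambda>s. cnj (f s)) \<in> borel_measurable M"
proof -
  have "cnj \<in> borel_measurable borel"
    by (intro borel_measurable_continuous_onI continuous_intros)
  then show ?thesis
    using assms by (rule measurable_compose[rotated])
qed

lemma square_integrable_measurable [measurable_dest]:
  "square_integrable f \<Longrightarrow> f \<in> borel_measurable unit_interval"
  by (simp add: square_integrable_def)

lemma square_integrable_cnj: "square_integrable f \<Longrightarrow> square_integrable (\<lambda>s. cnj (f s))"
  by (simp add: square_integrable_def borel_measurable_cnj)

lemma square_integrable_bound:
  assumes "square_integrable g" "f \<in> borel_measurable unit_interval"
    and "\<And>s. 0 < s \<Longrightarrow> s < 1 \<Longrightarrow> cmod (f s) \<le> cmod (g s)"
  shows "square_integrable f"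
  unfolding square_integrable_def
proof
  have [measurable]: "f \<in> borel_measurable unit_interval" by fact
  have "integrable unit_interval (\<lambda>s. (cmod (g s))\<^sup>2)"
    using assms by (simp add: square_integrable_def)
  then show "integrable unit_interval (\<lambda>s. (cmod (f s))\<^sup>2)"
    by (rule Bochner_Integration.integrable_bound) (use assms in \<open>auto intro!: AE_I2 power_mono\<close>)
qed fact

lemma square_integrable_integrable_mult:
  assumes [measurable]: "square_integrable f" "square_integrable g"
  shows "integrable unit_interval (\<lambda>s. f s * g s)"
proof (rule Bochner_Integration.integrable_bound)
  show "integrable unit_interval (\<lambda>s. (cmod (f s))\<^sup>2 + (cmod (g s))\<^sup>2)"
    using assms by (auto simp: square_integrable_def)
  show "(\<lambda>s. f s * g s) \<in> borel_measurable unit_interval"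
    by measurable
  have "cmod (a * b) \<le> (cmod a)\<^sup>2 + (cmod b)\<^sup>2" for a b :: complex
  proof -
    have "0 \<le> cmod a * cmod b" by simp
    then show ?thesis
      using sum_squares_bound[of "cmod a" "cmod b"] unfolding norm_mult by linarith
  qed
  then show "AE s in unit_interval. norm (f s * g s) \<le> norm ((cmod (f s))\<^sup>2 + (cmod (g s))\<^sup>2)"
    by (auto intro!: AE_I2)
qed

lemma square_integrable_integrable:
  assumes "square_integrable f"
  shows "integrable unit_interval f"
proof -
  have "square_integrable (\<lambda>s. 1)"
    by (simp add: square_integrable_def)
  then show ?thesis
    using square_integrable_integrable_mult[OF assms] by fastforce
qed

section \<open>The inner product on L2 and its norm\<close>

lemma inner_L2_add: "inner_L2 (f + g) h = inner_L2 f h + inner_L2 g h"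
  by transfer
     (auto simp: algebra_simps square_integrable_integrable_mult square_integrable_cnj
       intro!: Bochner_Integration.integral_add)

lemma inner_L2_scale: "inner_L2 (scale_L2 c f) h = c * inner_L2 f h"
  by transfer (simp add: mult.assoc)

lemma inner_L2_commute: "inner_L2 g f = cnj (inner_L2 f g)"
proof -
  obtain F where F: "square_integrable F" "f = abs_L2 F"
    by (rule L2_cases)
  obtain G where G: "square_integrable G" "g = abs_L2 G"
    by (rule L2_cases)
  show ?thesis
    using F G Bochner_Integration.integral_cnj[of unit_interval "\<lambda>s. F s * cnj (G s)"]
    by (simp add: inner_L2.abs_eq mult.commute)
qed

lemma inner_L2_self:
  assumes "square_integrable f"
  shows "inner_L2 (abs_L2 f) (abs_L2 f) = of_real (LINT s|unit_interval. (cmod (f s))\<^sup>2)"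
  using assms by (simp add: inner_L2.abs_eq complex_norm_square[symmetric] del: of_real_power)

lemma scale_L2_add_right: "scale_L2 c (f + g) = scale_L2 c f + scale_L2 c g"
  by transfer (auto simp: eq_L2_def algebra_simps square_integrable_add square_integrable_mult)

lemma scale_L2_add_left: "scale_L2 (c + d) f = scale_L2 c f + scale_L2 d f"
  by transfer (auto simp: eq_L2_def algebra_simps square_integrable_add square_integrable_mult)

lemma scale_L2_scale_L2: "scale_L2 c (scale_L2 d f) = scale_L2 (c * d) f"
  by transfer (auto simp: eq_L2_def algebra_simps square_integrable_mult)

lemma scale_L2_one: "scale_L2 1 f = f"
  by transfer (auto simp: eq_L2_def)

text \<open>Energy identities involve only real parts, so the real part of the complex inner product
  serves as the inner product. It induces the same norm, and Cauchy-Schwarz and the calculus of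
  bounded linear maps become available.\<close>

instantiation L2 :: real_inner
begin

definition scaleR_L2_def: "r *\<^sub>R f = scale_L2 (of_real r) f"
definition inner_L2_real_def: "inner f g = Re (inner_L2 f g)"
definition norm_L2_def: "norm (f :: L2) = sqrt (inner f f)"
definition dist_L2_def: "dist (f :: L2) g = norm (f - g)"
definition sgn_L2_def: "sgn (f :: L2) = inverse (norm f) *\<^sub>R f"
definition uniformity_L2_def:
  "(uniformity :: (L2 \<times> L2) filter) = (INF e\<in>{0<..}. principal {(x, y). dist x y < e})"
definition open_L2_def:
  "open (S :: L2 set) \<longleftrightarrow> (\<forall>x\<in>S. \<forall>\<^sub>F (x', y) in uniformity. x' = x \<longrightarrow> y \<in> S)"

instance
proof
  fix f g h :: L2 and r s :: real
  show "r *\<^sub>R (f + g) = r *\<^sub>R f + r *\<^sub>R g" "(r + s) *\<^sub>R f = r *\<^sub>R f + s *\<^sub>R f"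
    "r *\<^sub>R s *\<^sub>R f = (r * s) *\<^sub>R f" "1 *\<^sub>R f = f"
    by (simp_all add: scaleR_L2_def scale_L2_add_right scale_L2_add_left scale_L2_scale_L2 scale_L2_one)
  show "dist f g = norm (f - g)" by (fact dist_L2_def)
  show "sgn f = inverse (norm f) *\<^sub>R f" by (fact sgn_L2_def)
  show "(uniformity :: (L2 \<times> L2) filter) = (INF e\<in>{0<..}. principal {(x, y). dist x y < e})"
    by (fact uniformity_L2_def)
  show "open S \<longleftrightarrow> (\<forall>x\<in>S. \<forall>\<^sub>F (x', y) in uniformity. x' = x \<longrightarrow> y \<in> S)" for S :: "L2 set"
    by (fact open_L2_def)
  show "inner f g = inner g f"
    by (simp add: inner_L2_real_def inner_L2_commute[of f])
  show "inner (f + g) h = inner f h + inner g h" "inner (r *\<^sub>R f) g = r * inner f g"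
    by (simp_all add: inner_L2_real_def inner_L2_add inner_L2_scale scaleR_L2_def)
  obtain F where F: "square_integrable F" "f = abs_L2 F"
    by (rule L2_cases)
  show "0 \<le> inner f f"
    using F by (simp add: inner_L2_real_def inner_L2_self)
  have "(LINT s|unit_interval. (cmod (F s))\<^sup>2) = 0 \<longleftrightarrow> (AE s in unit_interval. (cmod (F s))\<^sup>2 = 0)"
    using F by (intro integral_nonneg_eq_0_iff_AE) (auto simp: square_integrable_def)
  then show "inner f f = 0 \<longleftrightarrow> f = 0"
    using F by (simp add: inner_L2_real_def inner_L2_self zero_L2_def abs_L2_eq_iff square_integrable_zero)
  show "norm f = sqrt (inner f f)" by (fact norm_L2_def)
qed

end

lemma norm_abs_L2:
  assumes "square_integrable f"
  shows "norm (abs_L2 f) = sqrt (LINT s|unit_interval. (cmod (f s))\<^sup>2)"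
  using assms by (simp add: norm_L2_def inner_L2_real_def inner_L2_self)

lemma norm_abs_L2_le:
  assumes "square_integrable f" "\<And>s. 0 < s \<Longrightarrow> s < 1 \<Longrightarrow> cmod (f s) \<le> c" "c \<ge> 0"
  shows "norm (abs_L2 f) \<le> c"
proof -
  have "(LINT s|unit_interval. (cmod (f s))\<^sup>2) \<le> (LINT s|unit_interval. c\<^sup>2)"
    using assms by (intro integral_mono_AE AE_I2 power_mono) (auto simp: square_integrable_def)
  then show ?thesis
    using assms by (simp add: norm_abs_L2 real_le_lsqrt)
qed

text \<open>Dominated convergence applied to squared moduli. It is the common source of smallness
  for truncations of functions and for correctors at the boundary.\<close>

lemma tendsto_norm_abs_L2_dominated:
  assumes f: "\<And>n. square_integrable (f n)" and g: "integrable unit_interval (\<lambda>s. (g s)\<^sup>2)"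
    and bound: "\<And>n s. 0 < s \<Longrightarrow> s < 1 \<Longrightarrow> cmod (f n s) \<le> g s"
    and lim: "AE s in unit_interval. (\<lambda>n. f n s) \<longlonglongrightarrow> 0"
  shows "(\<lambda>n. norm (abs_L2 (f n))) \<longlonglongrightarrow> 0"
proof -
  have [measurable]: "f n \<in> borel_measurable unit_interval" for n
    using f by (simp add: square_integrable_def)
  have "(\<lambda>n. LINT s|unit_interval. (cmod (f n s))\<^sup>2) \<longlonglongrightarrow> (LINT s|unit_interval. 0)"
  proof (rule integral_dominated_convergence[where w = "\<lambda>s. (g s)\<^sup>2"])
    show "AE s in unit_interval. (\<lambda>n. (cmod (f n s))\<^sup>2) \<longlonglongrightarrow> 0"
      using lim by eventually_elim (auto intro!: tendsto_eq_intros)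
    show "AE s in unit_interval. norm ((cmod (f n s))\<^sup>2) \<le> (g s)\<^sup>2" for n
      using bound by (auto intro!: AE_I2 power_mono)
  qed (use g in auto)
  then have "(\<lambda>n. sqrt (LINT s|unit_interval. (cmod (f n s))\<^sup>2)) \<longlonglongrightarrow> sqrt 0"
    by (intro tendsto_real_sqrt) simp
  then show ?thesis
    using f by (simp add: norm_abs_L2)
qed

section \<open>Continuous representatives and their point values\<close>

lemma square_integrable_continuous:
  assumes "continuous_on {0..1} f"
  shows "square_integrable f"
  unfolding square_integrable_def
proof
  show [measurable]: "f \<in> borel_measurable unit_interval"
    by (intro continuous_imp_measurable_on_sets_lebesgue continuous_on_subset[OF assms]) auto
  have "bounded (f ` {0..1})"
    using assms by (intro compact_imp_bounded compact_continuous_image) auto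
  then obtain B where "\<And>s. s \<in> {0..1} \<Longrightarrow> cmod (f s) \<le> B"
    by (meson bounded_iff imageI)
  then show "integrable unit_interval (\<lambda>s. (cmod (f s))\<^sup>2)"
    by (intro unit_interval.integrable_const_bound[where B = "B\<^sup>2"]) (auto intro!: AE_I2 power_mono)
qed

text \<open>The set \<open>N\<close> of disagreement inside the open interval is open and null,
  hence empty; taking closures adds the two endpoints. This makes boundary values of an L2 class
  well defined.\<close>

lemma continuous_AE_unit_interval_imp_eq:
  fixes F G :: "real \<Rightarrow> complex"
  assumes "continuous_on {0..1} F" "continuous_on {0..1} G" "AE s in unit_interval. F s = G s"
    and "s \<in> {0..1}"
  shows "F s = G s"
proof -
  define N where "N = {0<..<1} \<inter> (\<lambda>s. F s - G s) -` (- {0})"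
  have cont: "continuous_on {0..1} (\<lambda>s. F s - G s)"
    by (intro continuous_intros assms)
  have "open N"
    unfolding N_def
    by (rule continuous_open_preimage) (auto intro: continuous_on_subset[OF cont])
  moreover have "negligible N"
  proof -
    have "AE s in lebesgue. s \<in> {0<..<1} \<longrightarrow> F s = G s"
      using assms(3) by (simp add: AE_restrict_space_iff)
    then have "AE s in lebesgue. s \<notin> N"
      by eventually_elim (auto simp: N_def)
    then show ?thesis
      by (simp add: negligible_iff_null_sets AE_iff_null_sets completion.AE_iff_null_sets)
  qed
  ultimately have "N = {}"
    using open_not_negligible by blast
  then have "{0<..<1} \<subseteq> {s \<in> {0..1}. F s - G s = 0}"
    by (auto simp: N_def)
  moreover have "closed {s \<in> {0..1}. F s - G s = 0}"
    by (intro continuous_closed_preimage_constant cont) auto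
  ultimately have "closure {0<..<1} \<subseteq> {s \<in> {0..1}. F s - G s = 0}"
    by (rule closure_minimal)
  then show ?thesis
    using assms(4) by auto
qed

lemma value_at_abs_L2:
  assumes "continuous_on {0..1} F" "a \<in> {0..1}"
  shows "value_at (abs_L2 F) a = F a"
proof -
  have "value_at (abs_L2 F) a =
      (THE y. \<exists>G. continuous_on {0..1} G \<and> (AE s in unit_interval. F s = G s) \<and> G a = y)"
    using assms by (subst value_at.abs_eq) (simp_all add: square_integrable_continuous)
  also have "\<dots> = F a"
  proof (rule the_equality)
    show "\<exists>G. continuous_on {0..1} G \<and> (AE s in unit_interval. F s = G s) \<and> G a = F a"
      using assms(1) by (intro exI[of _ F]) simp
  next
    fix y assume "\<exists>G. continuous_on {0..1} G \<and> (AE s in unit_interval. F s = G s) \<and> G a = y"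
    then obtain G where "continuous_on {0..1} G" "AE s in unit_interval. F s = G s" "G a = y"
      by blast
    then show "y = F a"
      using continuous_AE_unit_interval_imp_eq[OF assms(1) _ _ assms(2), of G] by simp
  qed
  finally show ?thesis .
qed

section \<open>Primitives, the product rule and integration by parts\<close>

text \<open>Pointwise counterpart of \<open>has_weak_deriv\<close>: \<open>F\<close> is itself the
  absolutely continuous representative on all of [0,1], so boundary values are plain function
  values. The derivative \<open>f\<close> matters only almost everywhere.\<close>

definition primitive :: "(real \<Rightarrow> complex) \<Rightarrow> (real \<Rightarrow> complex) \<Rightarrow> bool" where
  "primitive F f \<longleftrightarrow> square_integrable f \<and>
     (\<forall>s\<in>{0..1}. F s = F 0 + (LINT r:{0<..<s}|unit_interval. f r))"

lemma primitive_set_integral: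
  "primitive F f \<Longrightarrow> s \<in> {0..1} \<Longrightarrow> (LINT r:{0<..<s}|unit_interval. f r) = F s - F 0"
  unfolding primitive_def by (metis add_diff_cancel_left')

lemma has_integral_set_lebesgue_unit_interval:
  assumes "square_integrable f" "s \<in> {0..1}"
  shows "(f has_integral (LINT r:{0<..<s}|unit_interval. f r)) {0..s}"
proof -
  have "integrable unit_interval (\<lambda>r. indicat_real {0<..<s} r *\<^sub>R f r)"
    using square_integrable_integrable[OF assms(1)]
    by (intro integrable_mult_indicator) (use assms(2) in \<open>auto simp: sets_restrict_space_iff\<close>)
  then have "((\<lambda>r. indicat_real {0<..<s} r *\<^sub>R f r) has_integral
      (LINT r:{0<..<s}|unit_interval. f r)) {0<..<1}"
    unfolding set_lebesgue_integral_def by (rule has_integral_integral_lebesgue_on) simp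
  then have "(f has_integral (LINT r:{0<..<s}|unit_interval. f r)) {0<..<s}"
    unfolding indicator_scaleR_eq_if by (subst (asm) has_integral_restrict) (use assms(2) in auto)
  then show ?thesis
    by (simp add: has_integral_Icc_iff_Ioo)
qed

text \<open>Passing to the gauge integral on closed intervals gives access to the fundamental
  theorem of calculus and to the continuity and linearity of indefinite integrals.\<close>

lemma primitive_iff_has_integral:
  "primitive F f \<longleftrightarrow> square_integrable f \<and> (\<forall>s\<in>{0..1}. (f has_integral (F s - F 0)) {0..s})"
proof -
  have "F s = F 0 + (LINT r:{0<..<s}|unit_interval. f r) \<longleftrightarrow> (f has_integral (F s - F 0)) {0..s}"
    if "square_integrable f" "s \<in> {0..1}" for s
  proof -
    note int = has_integral_set_lebesgue_unit_interval[OF that]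
    show ?thesis
    proof
      assume "(f has_integral (F s - F 0)) {0..s}"
      then have "F s - F 0 = (LINT r:{0<..<s}|unit_interval. f r)"
        using int by (rule has_integral_unique)
      then show "F s = F 0 + (LINT r:{0<..<s}|unit_interval. f r)"
        by (simp add: algebra_simps)
    qed (use int in simp)
  qed
  then show ?thesis
    unfolding primitive_def by blast
qed

lemma primitive_continuous:
  assumes "primitive F f"
  shows "continuous_on {0..1} F"
proof -
  have int: "(f has_integral (F s - F 0)) {0..s}" if "s \<in> {0..1}" for s
    using assms that by (simp add: primitive_iff_has_integral)
  have "continuous_on {0..1} (\<lambda>s. F 0 + integral {0..s} f)"
    using int[of 1] by (intro continuous_intros indefinite_integral_continuous_1) (auto simp: integrable_on_def)
  then show ?thesis
    by (rule continuous_on_eq) (simp add: integral_unique[OF int])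
qed

lemma primitive_square_integrable:
  assumes "primitive F f"
  shows "square_integrable F" "square_integrable f"
  using square_integrable_continuous[OF primitive_continuous[OF assms]] assms
  by (simp_all add: primitive_iff_has_integral)

lemma primitive_of_derivative:
  assumes "\<And>s. s \<in> {0..1} \<Longrightarrow> (F has_vector_derivative f s) (at s)" "continuous_on {0..1} f"
  shows "primitive F f"
  unfolding primitive_iff_has_integral
  using assms by (auto intro!: square_integrable_continuous fundamental_theorem_of_calculus
      intro: has_vector_derivative_at_within)

lemma primitive_exists:
  assumes "square_integrable f"
  obtains F where "primitive F f" "F 0 = c"
proof (rule that)
  show "primitive (\<lambda>s. c + (LINT r:{0<..<s}|unit_interval. f r)) f"
    using assms by (simp add: primitive_def set_lebesgue_integral_def)
qed (simp add: set_lebesgue_integral_def)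

lemma primitive_cnj: "primitive F f \<Longrightarrow> primitive (\<lambda>s. cnj (F s)) (\<lambda>s. cnj (f s))"
  unfolding primitive_iff_has_integral complex_cnj_diff[symmetric]
  using has_integral_cnj[of f] by (auto simp: square_integrable_cnj o_def simp del: complex_cnj_diff)

lemma primitive_diff:
  assumes "primitive F f" "primitive G g"
  shows "primitive (\<lambda>s. F s - G s) (\<lambda>s. f s - g s)"
  unfolding primitive_iff_has_integral
proof safe
  fix s :: real assume "s \<in> {0..1}"
  then have "((\<lambda>s. f s - g s) has_integral (F s - F 0) - (G s - G 0)) {0..s}"
    using assms by (intro has_integral_diff) (auto simp: primitive_iff_has_integral)
  then show "((\<lambda>s. f s - g s) has_integral F s - G s - (F 0 - G 0)) {0..s}"
    by (simp add: algebra_simps)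
qed (use assms primitive_square_integrable square_integrable_diff in auto)

lemma square_integrable_mult_continuous:
  assumes "square_integrable f" "continuous_on {0..1} G"
  shows "square_integrable (\<lambda>s. f s * G s)"
proof -
  have "bounded (G ` {0..1})"
    using assms by (intro compact_imp_bounded compact_continuous_image) auto
  then obtain B where B: "\<And>s. s \<in> {0..1} \<Longrightarrow> cmod (G s) \<le> B"
    by (meson bounded_iff imageI)
  have [measurable]: "f \<in> borel_measurable unit_interval" "G \<in> borel_measurable unit_interval"
    using assms square_integrable_continuous by (auto simp: square_integrable_def)
  show ?thesis
  proof (rule square_integrable_bound[OF square_integrable_mult[OF assms(1), of "of_real B"]])
    fix s :: real assume "0 < s" "s < 1"
    then have "cmod (G s) \<le> \<bar>B\<bar>"
      using B[of s] by auto
    then show "cmod (f s * G s) \<le> cmod (of_real B * f s)"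
      by (simp add: norm_mult mult.commute[of "cmod (f s)"] mult_right_mono)
  qed measurable
qed

text \<open>Both sides integrate \<open>f r * g s\<close> over the triangle r < s < t, in the two
  possible orders. This is integration by parts in a form that never differentiates \<open>F\<close>
  or \<open>G\<close> at a point.\<close>

lemma integral_triangle_swap:
  assumes f: "primitive F f" and g: "primitive G g" and t: "t \<in> {0..1}"
  shows "(LINT s:{0<..<t}|unit_interval. (F s - F 0) * g s) = (LINT r:{0<..<t}|unit_interval. f r * (G t - G r))"
proof -
  let ?M = unit_interval
  interpret pair_sigma_finite ?M ?M ..
  note [measurable] = primitive_square_integrable(2)[OF f, THEN square_integrable_measurable]
    primitive_square_integrable(2)[OF g, THEN square_integrable_measurable]
  have id_meas [measurable]: "(\<lambda>x. x) \<in> borel_measurable ?M"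
    by (intro continuous_imp_measurable_on_sets_lebesgue) auto
  have if_int: "integrable ?M f" and ig: "integrable ?M g"
    using f g by (auto intro: square_integrable_integrable primitive_square_integrable)
  have ind: "integrable ?M (\<lambda>r. indicat_real {0<..<s} r *\<^sub>R h r)" if "integrable ?M h" "s \<le> 1" for s and h :: "real \<Rightarrow> complex"
    using that by (intro integrable_mult_indicator) (auto simp: sets_restrict_space_iff)
  have F: "(LINT r|?M. indicat_real {0<..<s} r *\<^sub>R f r) = F s - F 0" if "s \<in> {0..1}" for s
    using primitive_set_integral[OF f that] by (simp add: set_lebesgue_integral_def)
  have G: "(LINT r|?M. indicat_real {0<..<s} r *\<^sub>R g r) = G s - G 0" if "s \<in> {0..1}" for s
    using primitive_set_integral[OF g that] by (simp add: set_lebesgue_integral_def)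
  have "integrable (?M \<Otimes>\<^sub>M ?M) (\<lambda>p. f (fst p) * g (snd p))"
  proof (rule Fubini_integrable)
    show "integrable ?M (\<lambda>x. LINT y|?M. norm (f (fst (x, y)) * g (snd (x, y))))"
      using if_int by (simp add: norm_mult)
    show "AE x in ?M. integrable ?M (\<lambda>y. f (fst (x, y)) * g (snd (x, y)))"
      using ig by simp
  qed measurable
  moreover have "{p \<in> space (?M \<Otimes>\<^sub>M ?M). fst p < snd p \<and> snd p < t} \<in> sets (?M \<Otimes>\<^sub>M ?M)"
  proof -
    have [measurable]: "fst \<in> borel_measurable (?M \<Otimes>\<^sub>M ?M)" "snd \<in> borel_measurable (?M \<Otimes>\<^sub>M ?M)"
      using measurable_compose[OF measurable_fst id_meas] measurable_compose[OF measurable_snd id_meas]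
      by auto
    show ?thesis by measurable
  qed
  ultimately have int: "integrable (?M \<Otimes>\<^sub>M ?M) (\<lambda>p. indicat_real {p \<in> space (?M \<Otimes>\<^sub>M ?M). fst p < snd p \<and> snd p < t} p *\<^sub>R (f (fst p) * g (snd p)))"
    by (rule integrable_mult_indicator[rotated])
  define A where "A r s = (if r < s \<and> s < t then f r * g s else 0)" for r s
  have "integrable (?M \<Otimes>\<^sub>M ?M) (case_prod A)"
    using int by (rule Bochner_Integration.integrable_cong[THEN iffD1, rotated 2])
      (auto simp: A_def indicator_def space_pair_measure)
  then have swap: "(LINT s|?M. LINT r|?M. A r s) = (LINT r|?M. LINT s|?M. A r s)"
    by (rule Fubini_integral)
  have "(LINT r|?M. A r s) = indicat_real {0<..<t} s *\<^sub>R ((F s - F 0) * g s)" if "s \<in> {0<..<1}" for s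
  proof (cases "s < t")
    case True
    then have "(LINT r|?M. A r s) = (LINT r|?M. indicat_real {0<..<s} r *\<^sub>R f r * g s)"
      by (intro Bochner_Integration.integral_cong) (auto simp: A_def indicator_def)
    also have "\<dots> = (F s - F 0) * g s"
      using F[of s] that by (simp only: integral_mult_left_zero) simp
    finally show ?thesis
      using True that by simp
  qed (simp add: A_def)
  then have 1: "(LINT s|?M. LINT r|?M. A r s) = (LINT s:{0<..<t}|?M. (F s - F 0) * g s)"
    unfolding set_lebesgue_integral_def by (intro Bochner_Integration.integral_cong) auto
  have "(LINT s|?M. A r s) = indicat_real {0<..<t} r *\<^sub>R (f r * (G t - G r))" if r: "r \<in> {0<..<1}" for r
  proof (cases "r < t")
    case True
    \<comment> \<open>The difference of the two indicators below is 1 at \<open>s = r\<close>, where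
      \<open>A r s\<close> vanishes, so the integrands agree only off this point.\<close>
    have "AE s in ?M. s \<noteq> r"
      using AE_completion[OF AE_lborel_singleton[of r]] by (auto simp: AE_restrict_space_iff elim: eventually_mono)
    then have "(LINT s|?M. A r s) = (LINT s|?M. f r * (indicat_real {0<..<t} s *\<^sub>R g s - indicat_real {0<..<r} s *\<^sub>R g s))"
    proof (intro integral_cong_AE)
      show "A r \<in> borel_measurable ?M"
        unfolding A_def by measurable
      show "(\<lambda>s. f r * (indicat_real {0<..<t} s *\<^sub>R g s - indicat_real {0<..<r} s *\<^sub>R g s)) \<in> borel_measurable ?M"
        using ind[OF ig, of t] ind[OF ig, of r] t r by (intro borel_measurable_times borel_measurable_diff borel_measurable_integrable) auto
      show "AE s in ?M. s \<noteq> r \<Longrightarrow> AE s in ?M. A r s = f r * (indicat_real {0<..<t} s *\<^sub>R g s - indicat_real {0<..<r} s *\<^sub>R g s)"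
        using True r by (auto simp: A_def indicator_def AE_restrict_space_iff elim!: eventually_mono)
    qed
    also have "\<dots> = f r * (G t - G r)"
      using ind[OF ig, of t] ind[OF ig, of r] t r by (simp add: G)
    finally show ?thesis
      using True r by simp
  next
    case False
    then have "A r = (\<lambda>s. 0)"
      by (intro ext) (auto simp: A_def)
    then show ?thesis
      using False by simp
  qed
  then have 2: "(LINT r|?M. LINT s|?M. A r s) = (LINT r:{0<..<t}|?M. f r * (G t - G r))"
    unfolding set_lebesgue_integral_def by (intro Bochner_Integration.integral_cong) auto
  show ?thesis
    using swap 1 2 by simp
qed

text \<open>The triangle identity, expanded and rearranged. Continuity of \<open>F\<close> and
  \<open>G\<close> keeps the two products in the derivative square integrable.\<close>

lemma primitive_mult:
  assumes f: "primitive F f" and g: "primitive G g"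
  shows "primitive (\<lambda>s. F s * G s) (\<lambda>s. f s * G s + F s * g s)"
  unfolding primitive_def
proof safe
  note sq = primitive_square_integrable[OF f] primitive_square_integrable[OF g]
  have fG: "square_integrable (\<lambda>s. f s * G s)"
    by (intro square_integrable_mult_continuous sq primitive_continuous[OF g])
  have gF: "square_integrable (\<lambda>s. F s * g s)"
    using square_integrable_mult_continuous[OF sq(4) primitive_continuous[OF f]] by (simp add: mult.commute)
  show "square_integrable (\<lambda>s. f s * G s + F s * g s)"
    by (intro square_integrable_add fG gF)
  fix t :: real assume t: "t \<in> {0..1}"
  let ?I = "\<lambda>h. LINT s:{0<..<t}|unit_interval. h s :: complex"
  have int: "set_integrable unit_interval {0<..<t} h" if "square_integrable h" for h
    unfolding set_integrable_def using that t square_integrable_integrable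
    by (intro integrable_mult_indicator) (auto simp: sets_restrict_space_iff)
  have "?I (\<lambda>s. F s * g s - F 0 * g s) = ?I (\<lambda>s. G t * f s - f s * G s)"
    using integral_triangle_swap[OF f g t] by (simp add: algebra_simps)
  moreover have "?I (\<lambda>s. F s * g s - F 0 * g s) = ?I (\<lambda>s. F s * g s) - F 0 * ?I g"
    using int[OF gF] int[OF sq(4)] by (simp add: set_integral_diff)
  moreover have "?I (\<lambda>s. G t * f s - f s * G s) = G t * ?I f - ?I (\<lambda>s. f s * G s)"
    using int[OF fG] int[OF sq(2)] by (simp add: set_integral_diff)
  moreover have "?I (\<lambda>s. f s * G s + F s * g s) = ?I (\<lambda>s. f s * G s) + ?I (\<lambda>s. F s * g s)"
    using int[OF fG] int[OF gF] by (simp add: set_integral_add)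
  moreover have "?I f = F t - F 0" "?I g = G t - G 0"
    using f g t by (simp_all add: primitive_set_integral)
  ultimately have "?I (\<lambda>s. f s * G s + F s * g s) = G t * (F t - F 0) + F 0 * (G t - G 0)"
    by (simp add: diff_eq_eq)
  then show "F t * G t = F 0 * G 0 + ?I (\<lambda>s. f s * G s + F s * g s)"
    by (simp add: algebra_simps)
qed

section \<open>Density of polynomials in L2\<close>

lemma norm_abs_L2_diff:
  assumes "square_integrable f" "square_integrable g"
  shows "norm (abs_L2 f - abs_L2 g) = norm (abs_L2 (\<lambda>s. f s - g s))"
  using assms by (simp add: minus_L2.abs_eq)

text \<open>Three errors of size \<open>e / 3\<close>: truncation to a bounded function, replacement
  by a continuous function, and the Weierstrass theorem on [0,1].\<close>

lemma polynomial_function_dense_L2: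
  assumes f: "square_integrable f" and "e > 0"
  obtains p where "polynomial_function p" "norm (abs_L2 f - abs_L2 p) < e"
proof -
  \<comment> \<open>A continuous truncation: \<open>c n\<close> is bounded by \<open>n + 1\<close>,
    tends to the identity as \<open>n\<close> grows, and moves \<open>z\<close> by at most
    \<open>cmod z\<close>, which yields the dominating function.\<close>
  define c where "c n z = (1 / (1 + cmod z * inverse (real (Suc n)))) *\<^sub>R z" for n z
  have pos: "1 + cmod z * inverse (real (Suc n)) > 0" for n z
    by (intro add_pos_nonneg) auto
  have cont_c: "continuous_on UNIV (c n)" for n
    unfolding c_def using pos by (intro continuous_intros) (auto simp: less_imp_neq[symmetric])
  have c_bounded: "cmod (c n z) \<le> real n + 1" for n z
    using pos[of z n] by (simp add: c_def field_simps)
  have c_diff: "cmod (z - c n z) \<le> cmod z" for n z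
  proof -
    define k where "k = 1 / (1 + cmod z * inverse (real (Suc n)))"
    have "0 \<le> k" "k \<le> 1"
      unfolding k_def using pos[of z n] by (auto simp: divide_le_eq_1)
    moreover have "z - c n z = (1 - k) *\<^sub>R z"
      by (simp add: c_def k_def algebra_simps)
    ultimately show ?thesis
      by (simp add: mult_left_le_one_le)
  qed
  have c_tendsto: "(\<lambda>n. c n z) \<longlonglongrightarrow> z" for z
  proof -
    have "(\<lambda>n. cmod z * inverse (real (Suc n))) \<longlonglongrightarrow> cmod z * 0"
      by (intro tendsto_intros LIMSEQ_inverse_real_of_nat)
    then have "(\<lambda>n. (1 / (1 + cmod z * inverse (real (Suc n)))) *\<^sub>R z) \<longlonglongrightarrow> (1 / (1 + cmod z * 0)) *\<^sub>R z"
      by (intro tendsto_scaleR tendsto_divide tendsto_add tendsto_const) auto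
    then show ?thesis
      by (simp add: c_def)
  qed
  have [measurable]: "f \<in> borel_measurable unit_interval"
    using f by (simp add: square_integrable_def)
  have c_meas[measurable]: "c n \<in> borel_measurable borel" for n
    by (intro borel_measurable_continuous_onI cont_c)
  have sq_c: "square_integrable (\<lambda>s. c n (h s))" if "h \<in> borel_measurable unit_interval" for n h
  proof (rule square_integrable_bound[of "\<lambda>s. of_real (real n + 1)"])
    show "square_integrable (\<lambda>s. of_real (real n + 1))"
      by (intro square_integrable_continuous continuous_intros)
    show "(\<lambda>s. c n (h s)) \<in> borel_measurable unit_interval"
      using that by measurable
    show "cmod (c n (h s)) \<le> cmod (of_real (real n + 1))" for s
      using c_bounded[of n "h s"] unfolding norm_of_real by linarith
  qed
  have "(\<lambda>n. norm (abs_L2 (\<lambda>s. f s - c n (f s)))) \<longlonglongrightarrow> 0"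
  proof (rule tendsto_norm_abs_L2_dominated[where g = "\<lambda>s. cmod (f s)"])
    show "AE s in unit_interval. (\<lambda>n. f s - c n (f s)) \<longlonglongrightarrow> 0"
    proof (rule AE_I2)
      show "(\<lambda>n. f s - c n (f s)) \<longlonglongrightarrow> 0" for s
        using tendsto_diff[OF tendsto_const c_tendsto, of "f s" "f s"] by simp
    qed
    show "square_integrable (\<lambda>s. f s - c n (f s))" for n
      by (intro square_integrable_diff sq_c f) measurable
    show "integrable unit_interval (\<lambda>s. (cmod (f s))\<^sup>2)"
      using f by (simp add: square_integrable_def)
  qed (rule c_diff)
  then have "\<forall>\<^sub>F n in sequentially. norm (abs_L2 (\<lambda>s. f s - c n (f s))) < e / 3"
    using \<open>e > 0\<close> by (intro order_tendstoD) auto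
  then obtain n where n: "norm (abs_L2 (\<lambda>s. f s - c n (f s))) < e / 3"
    using eventually_happens'[OF sequentially_bot] by blast
  \<comment> \<open>Measurability provides continuous \<open>g k\<close> converging to
    \<open>f\<close> almost everywhere but with no common bound; composing them with
    \<open>c n\<close> supplies a constant one.\<close>
  have "f measurable_on {0<..<1}"
    by (simp add: measurable_on_iff_borel_measurable)
  then obtain N g where N: "negligible N" and g: "\<And>k. continuous_on UNIV (g k)"
    and lim: "\<And>s. s \<notin> N \<Longrightarrow> (\<lambda>k. g k s) \<longlonglongrightarrow> (if s \<in> {0<..<1} then f s else 0)"
    unfolding measurable_on_def by blast
  have cont_g: "continuous_on {0..1} (\<lambda>s. c n (g k s))" for k
    by (rule continuous_on_compose2[OF cont_c continuous_on_subset[OF g]]) auto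
  have "(\<lambda>k. norm (abs_L2 (\<lambda>s. c n (f s) - c n (g k s)))) \<longlonglongrightarrow> 0"
  proof (rule tendsto_norm_abs_L2_dominated[where g = "\<lambda>s. real n + 1 + (real n + 1)"])
    show "square_integrable (\<lambda>s. c n (f s) - c n (g k s))" for k
      by (intro square_integrable_diff sq_c square_integrable_continuous cont_g) measurable
    show "cmod (c n (f s) - c n (g k s)) \<le> real n + 1 + (real n + 1)" for k s
      by (rule order_trans[OF norm_triangle_ineq4 add_mono[OF c_bounded c_bounded]])
    have "AE s in lebesgue. s \<notin> N"
      using N by (simp add: negligible_iff_null_sets AE_iff_null_sets AE_not_in)
    then have "AE s in lebesgue. s \<in> {0<..<1} \<longrightarrow> (\<lambda>k. c n (f s) - c n (g k s)) \<longlonglongrightarrow> 0"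
    proof eventually_elim
      case (elim s)
      show ?case
      proof
        assume "s \<in> {0<..<1}"
        then have "(\<lambda>k. g k s) \<longlonglongrightarrow> f s"
          using lim[OF elim] by simp
        then have "(\<lambda>k. c n (g k s)) \<longlonglongrightarrow> c n (f s)"
          by (intro continuous_on_tendsto_compose[OF cont_c[of n]]) auto
        from tendsto_diff[OF tendsto_const this, of "c n (f s)"]
        show "(\<lambda>k. c n (f s) - c n (g k s)) \<longlonglongrightarrow> 0"
          by simp
      qed
    qed
    then show "AE s in unit_interval. (\<lambda>k. c n (f s) - c n (g k s)) \<longlonglongrightarrow> 0"
      by (simp add: AE_restrict_space_iff)
  qed auto
  then have "\<forall>\<^sub>F k in sequentially. norm (abs_L2 (\<lambda>s. c n (f s) - c n (g k s))) < e / 3"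
    using \<open>e > 0\<close> by (intro order_tendstoD) auto
  then obtain k where k: "norm (abs_L2 (\<lambda>s. c n (f s) - c n (g k s))) < e / 3"
    using eventually_happens'[OF sequentially_bot] by blast
  obtain p where p: "polynomial_function p" "\<And>s. s \<in> {0..1} \<Longrightarrow> cmod (c n (g k s) - p s) < e / 3"
    using Stone_Weierstrass_polynomial_function[OF compact_Icc cont_g[of k], of "e / 3"]
      divide_pos_pos[OF \<open>e > 0\<close>, of 3] by (meson zero_less_numeral)
  have sq_p: "square_integrable p"
    by (intro square_integrable_continuous continuous_on_polymonial_function p)
  have sq_g: "square_integrable (\<lambda>s. c n (g k s))" and sq_f: "square_integrable (\<lambda>s. c n (f s))"
    by (intro square_integrable_continuous cont_g, intro sq_c) measurable
  have "norm (abs_L2 (\<lambda>s. c n (g k s) - p s)) \<le> e / 3"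
    using p(2) \<open>e > 0\<close> by (intro norm_abs_L2_le square_integrable_diff sq_g sq_p) (auto intro: less_imp_le)
  then have "norm (abs_L2 f - abs_L2 (\<lambda>s. c n (f s))) < e / 3"
      "norm (abs_L2 (\<lambda>s. c n (f s)) - abs_L2 (\<lambda>s. c n (g k s))) < e / 3"
      "norm (abs_L2 (\<lambda>s. c n (g k s)) - abs_L2 p) \<le> e / 3"
    using n k f sq_f sq_g sq_p by (simp_all only: norm_abs_L2_diff)
  then have "norm (abs_L2 f - abs_L2 p) < e"
    using norm_triangle_ineq[of "abs_L2 f - abs_L2 (\<lambda>s. c n (f s))" "abs_L2 (\<lambda>s. c n (f s)) - abs_L2 (\<lambda>s. c n (g k s))"]
      norm_triangle_ineq[of "abs_L2 f - abs_L2 (\<lambda>s. c n (g k s))" "abs_L2 (\<lambda>s. c n (g k s)) - abs_L2 p"]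
    by simp
  then show thesis
    by (rule that[OF p(1)])
qed

section \<open>Weak derivatives and Sobolev classes through primitives\<close>

lemma primitive_has_weak_deriv:
  assumes "primitive F f"
  shows "has_weak_deriv (abs_L2 F) (abs_L2 f)"
proof -
  have "AE s in unit_interval. F s = F 0 + (LINT r:{0<..<s}|unit_interval. f r)"
  proof (rule AE_I2)
    fix s assume "s \<in> space unit_interval"
    then have "s \<in> {0..1}" by simp
    then show "F s = F 0 + (LINT r:{0<..<s}|unit_interval. f r)"
      using assms unfolding primitive_def by blast
  qed
  then show ?thesis
    using primitive_square_integrable[OF assms] by (subst has_weak_deriv.abs_eq) auto
qed

lemma has_weak_derivE:
  assumes "has_weak_deriv x (abs_L2 g)" "square_integrable g"
  obtains F where "primitive F g" "x = abs_L2 F"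
proof -
  obtain f where f: "square_integrable f" "x = abs_L2 f"
    by (rule L2_cases)
  then obtain c where c: "AE s in unit_interval. f s = c + (LINT r:{0<..<s}|unit_interval. g r)"
    using assms by (auto simp: has_weak_deriv.abs_eq)
  obtain F where F: "primitive F g" "F 0 = c"
    using primitive_exists[OF assms(2)] by metis
  have "AE s in unit_interval. F s = c + (LINT r:{0<..<s}|unit_interval. g r)"
  proof (rule AE_I2)
    fix s assume "s \<in> space unit_interval"
    then have "s \<in> {0..1}" by simp
    then show "F s = c + (LINT r:{0<..<s}|unit_interval. g r)"
      using F unfolding primitive_def by blast
  qed
  with c have "AE s in unit_interval. f s = F s"
    by eventually_elim simp
  then have "x = abs_L2 F"
    using f primitive_square_integrable[OF F(1)] by (simp add: abs_L2_eq_iff)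
  with F(1) show thesis
    by (rule that)
qed

lemma inner_abs_L2:
  assumes "square_integrable f" "square_integrable g"
  shows "inner (abs_L2 f) (abs_L2 g) = Re (LINT s|unit_interval. f s * cnj (g s))"
  using assms by (simp add: inner_L2_real_def inner_L2.abs_eq)

lemma set_lebesgue_integral_unit_interval:
  "(LINT s:{0<..<1}|unit_interval. f s) = (LINT s|unit_interval. f s)"
  unfolding set_lebesgue_integral_def by (intro Bochner_Integration.integral_cong) auto

text \<open>The product rule for \<open>F\<close> and the conjugate of \<open>G\<close>, integrated
  over the interval. The boundary conditions act in the decay estimate through the right-hand
  side.\<close>

lemma primitive_integration_by_parts:
  assumes F: "primitive F f" and G: "primitive G g"
  shows "inner (abs_L2 f) (abs_L2 G) + inner (abs_L2 F) (abs_L2 g) = inner (F 1) (G 1) - inner (F 0) (G 0)"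
proof -
  note sq = primitive_square_integrable[OF F] primitive_square_integrable[OF G]
  have "primitive (\<lambda>s. F s * cnj (G s)) (\<lambda>s. f s * cnj (G s) + F s * cnj (g s))"
    by (intro primitive_mult primitive_cnj assms)
  from primitive_set_integral[OF this, of 1] have "F 1 * cnj (G 1) - F 0 * cnj (G 0)
      = (LINT s:{0<..<1}|unit_interval. f s * cnj (G s) + F s * cnj (g s))"
    by simp
  also have "\<dots> = (LINT s|unit_interval. f s * cnj (G s)) + (LINT s|unit_interval. F s * cnj (g s))"
    unfolding set_lebesgue_integral_unit_interval
    by (intro Bochner_Integration.integral_add square_integrable_integrable_mult square_integrable_cnj sq)
  finally have "Re (F 1 * cnj (G 1) - F 0 * cnj (G 0))
      = Re ((LINT s|unit_interval. f s * cnj (G s)) + (LINT s|unit_interval. F s * cnj (g s)))"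
    by (rule arg_cong)
  then show ?thesis
    using sq by (simp add: inner_abs_L2 inner_complex_def)
qed

text \<open>The zero function is a primitive of \<open>h\<close>, so integration by parts makes
  \<open>h\<close> orthogonal to every polynomial, and density forces it to vanish. Lebesgue
  differentiation is thereby avoided.\<close>

lemma abs_L2_eq_zeroI:
  assumes h: "square_integrable h" and "\<And>s. s \<in> {0..1} \<Longrightarrow> (LINT r:{0<..<s}|unit_interval. h r) = 0"
  shows "abs_L2 h = 0"
proof -
  let ?x = "abs_L2 h"
  have h0: "primitive (\<lambda>s. 0) h"
    using assms by (simp add: primitive_def)
  have zero: "abs_L2 (\<lambda>s. 0) = 0"
    by (simp add: zero_L2_def)
  have "norm ?x \<le> 0"
  proof (rule field_le_epsilon)
    fix e :: real assume "e > 0"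
    then obtain p where p: "polynomial_function p" "norm (?x - abs_L2 p) < e"
      using polynomial_function_dense_L2[OF h] by metis
    obtain p' where p': "polynomial_function p'" "\<And>s. (p has_vector_derivative p' s) (at s)"
      using has_vector_derivative_polynomial_function[OF p(1)] by metis
    have "primitive p p'"
      by (intro primitive_of_derivative p' continuous_on_polymonial_function)
    then have "inner ?x (abs_L2 p) = 0"
      using primitive_integration_by_parts[OF h0, of p p'] by (simp add: zero)
    then have "norm ?x * norm ?x = inner ?x (?x - abs_L2 p)"
      by (simp add: inner_diff_right norm_eq_sqrt_inner)
    also have "\<dots> \<le> norm ?x * norm (?x - abs_L2 p)"
      by (rule norm_cauchy_schwarz)
    finally have "norm ?x \<le> norm (?x - abs_L2 p)"
      by (metis mult_le_cancel_left_pos norm_ge_zero order_le_less order_trans)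
    then show "norm ?x \<le> 0 + e"
      using p(2) by simp
  qed
  then show ?thesis
    by simp
qed

text \<open>Two primitives in the same class coincide on [0,1] by continuity, so their derivatives
  differ by a function all of whose integrals vanish. This resolves the definite description in
  \<open>weak_deriv\<close>.\<close>

lemma primitive_weak_deriv:
  assumes F: "primitive F f"
  shows "weak_deriv (abs_L2 F) = abs_L2 f"
  unfolding weak_deriv_def
proof (rule the_equality)
  show "has_weak_deriv (abs_L2 F) (abs_L2 f)"
    using F by (rule primitive_has_weak_deriv)
  fix y assume y: "has_weak_deriv (abs_L2 F) y"
  obtain g where g: "square_integrable g" "y = abs_L2 g"
    by (rule L2_cases)
  obtain G where G: "primitive G g" "abs_L2 F = abs_L2 G"
    using has_weak_derivE[of "abs_L2 F" g] y g by metis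
  have "AE s in unit_interval. F s = G s"
    using G F primitive_square_integrable by (simp add: abs_L2_eq_iff)
  then have eq: "F s = G s" if "s \<in> {0..1}" for s
    using that by (intro continuous_AE_unit_interval_imp_eq[OF primitive_continuous[OF F] primitive_continuous[OF G(1)]])
  have "primitive (\<lambda>s. F s - G s) (\<lambda>s. f s - g s)"
    by (intro primitive_diff F G)
  then have "abs_L2 (\<lambda>s. f s - g s) = 0"
    by (intro abs_L2_eq_zeroI primitive_square_integrable) (simp_all add: primitive_set_integral eq)
  then show "y = abs_L2 f"
    using g primitive_square_integrable[OF F] by (simp add: minus_L2.abs_eq[symmetric])
qed

lemma primitive_value_at: "primitive F f \<Longrightarrow> a \<in> {0..1} \<Longrightarrow> value_at (abs_L2 F) a = F a"
  by (intro value_at_abs_L2 primitive_continuous)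

lemma sobolev_2I:
  assumes "primitive F0 F1" "primitive F1 f2"
  shows "abs_L2 F0 \<in> sobolev 2"
  using primitive_has_weak_deriv[OF assms(1)] primitive_has_weak_deriv[OF assms(2)]
  by (auto simp: numeral_2_eq_2)

lemma sobolev_2E:
  assumes "x \<in> sobolev 2"
  obtains F0 F1 f2 where "primitive F0 F1" "primitive F1 f2" "x = abs_L2 F0"
proof -
  obtain y z where yz: "has_weak_deriv x y" "has_weak_deriv y z"
    using assms by (auto simp: numeral_2_eq_2)
  obtain f2 where f2: "square_integrable f2" "z = abs_L2 f2"
    by (rule L2_cases)
  obtain F1 where F1: "primitive F1 f2" "y = abs_L2 F1"
    using has_weak_derivE yz f2 by metis
  obtain F0 where "primitive F0 F1" "x = abs_L2 F0"
    using has_weak_derivE yz F1 primitive_square_integrable by metis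
  then show thesis
    using F1 that by blast
qed

lemma sobolev_4I:
  assumes "primitive F0 F1" "primitive F1 F2" "primitive F2 F3" "primitive F3 f4"
  shows "abs_L2 F0 \<in> sobolev 4"
proof -
  have four: "4 = Suc (Suc (2 :: nat))"
    by simp
  show ?thesis
    unfolding four sobolev.simps
    using sobolev_2I[OF assms(3,4)] primitive_has_weak_deriv[OF assms(1)] primitive_has_weak_deriv[OF assms(2)]
    by blast
qed

lemma sobolev_4E:
  assumes "x \<in> sobolev 4"
  obtains F0 F1 F2 F3 f4 where "primitive F0 F1" "primitive F1 F2" "primitive F2 F3" "primitive F3 f4"
    "x = abs_L2 F0"
proof -
  have four: "4 = Suc (Suc (2 :: nat))"
    by simp
  obtain y z where yz: "has_weak_deriv x y" "has_weak_deriv y z" "z \<in> sobolev 2"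
    using assms unfolding four sobolev.simps by blast
  obtain F2 F3 f4 where F2: "primitive F2 F3" "primitive F3 f4" "z = abs_L2 F2"
    using sobolev_2E yz(3) by metis
  obtain F1 where F1: "primitive F1 F2" "y = abs_L2 F1"
    using has_weak_derivE yz F2 primitive_square_integrable by metis
  obtain F0 where "primitive F0 F1" "x = abs_L2 F0"
    using has_weak_derivE yz F1 primitive_square_integrable by metis
  then show thesis
    using F1 F2 that by blast
qed

section \<open>Multiplication by the space variable, the weight of the multiplier\<close>

lemma square_integrable_mult_id: "square_integrable f \<Longrightarrow> square_integrable (\<lambda>s. of_real s * f s)"
  using square_integrable_mult_continuous[of f of_real] by (simp add: continuous_intros mult.commute)

lift_definition mult_id :: "L2 \<Rightarrow> L2" is "\<lambda>f s. of_real s * f s"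
  by (auto simp: eq_L2_def square_integrable_mult_id elim!: AE_mp)

lemma mult_id_add: "mult_id (f + g) = mult_id f + mult_id g"
  by transfer (auto simp: eq_L2_def distrib_left intro!: square_integrable_add square_integrable_mult_id)

lemma mult_id_scale: "mult_id (scale_L2 c f) = scale_L2 c (mult_id f)"
  by transfer (simp add: eq_L2_def mult.left_commute square_integrable_mult square_integrable_mult_id)

lemma bounded_linear_mult_id: "bounded_linear mult_id"
  and norm_mult_id_le: "norm (mult_id f) \<le> norm f"
proof -
  show le: "norm (mult_id f) \<le> norm f" for f
  proof -
    obtain F where F: "square_integrable F" "f = abs_L2 F"
      by (rule L2_cases)
    then have sq: "square_integrable (\<lambda>s. of_real s * F s)"
      by (simp add: square_integrable_mult_id)
    have "(LINT s|unit_interval. (cmod (of_real s * F s))\<^sup>2) \<le> (LINT s|unit_interval. (cmod (F s))\<^sup>2)"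
      using F sq by (intro integral_mono_AE AE_I2 power_mono)
        (auto simp: square_integrable_def norm_mult mult_left_le_one_le)
    then show ?thesis
      using F sq by (simp add: mult_id.abs_eq norm_abs_L2)
  qed
  show "bounded_linear mult_id"
  proof (rule bounded_linear_intro)
    show "mult_id (f + g) = mult_id f + mult_id g" for f g
      by (rule mult_id_add)
    show "mult_id (r *\<^sub>R f) = r *\<^sub>R mult_id f" for r f
      by (simp add: scaleR_L2_def mult_id_scale)
    show "norm (mult_id f) \<le> norm f * 1" for f
      using le by simp
  qed
qed

lemma inner_mult_id: "inner (mult_id f) g = inner f (mult_id g)"
  unfolding inner_L2_real_def by transfer (simp add: mult_ac)

lemma primitive_mult_id:
  assumes "primitive F f"
  shows "primitive (\<lambda>s. of_real s * F s) (\<lambda>s. F s + of_real s * f s)"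
proof -
  have "primitive of_real (\<lambda>s. 1)"
    by (rule primitive_of_derivative) (auto intro!: derivative_eq_intros)
  from primitive_mult[OF this assms] show ?thesis
    by simp
qed

section \<open>Lyapunov functionals for semigroups\<close>

text \<open>Subtracting the small slope \<open>k\<close> makes the right derivative of
  \<open>g\<close> strictly negative. If \<open>g b > g a\<close>, the last point with
  \<open>g c \<le> g a\<close> would lie before \<open>b\<close>, yet \<open>g\<close> decreases
  just to the right of it, giving a later such point.\<close>

lemma antimono_of_right_derivative_nonpos:
  fixes f f' :: "real \<Rightarrow> real"
  assumes "a \<le> b" and cont: "continuous_on {a..b} f"
    and der: "\<And>t. a \<le> t \<Longrightarrow> t < b \<Longrightarrow> (f has_real_derivative f' t) (at t within {t..})"
    and nonpos: "\<And>t. a \<le> t \<Longrightarrow> t < b \<Longrightarrow> f' t \<le> 0"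
  shows "f b \<le> f a"
proof (rule field_le_epsilon)
  fix e :: real assume "e > 0"
  define k where "k = e / (b - a + 1)"
  have k: "k > 0" "k * (b - a) \<le> e"
    using \<open>e > 0\<close> \<open>a \<le> b\<close> by (auto simp: k_def field_simps)
  define g where "g t = f t - k * (t - a)" for t
  have contg: "continuous_on {a..b} g"
    unfolding g_def by (intro continuous_intros cont)
  have "g b \<le> g a"
  proof (rule ccontr)
    assume neg: "\<not> g b \<le> g a"
    define S where "S = {a..b} \<inter> g -` {..g a}"
    have "closed S"
      unfolding S_def by (intro continuous_closed_preimage contg) auto
    moreover have "bounded S"
      unfolding S_def by (rule bounded_subset[of "{a..b}"]) auto
    ultimately have "compact S"
      by (simp add: compact_eq_bounded_closed)
    moreover have "S \<noteq> {}"
      using \<open>a \<le> b\<close> by (auto simp: S_def)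
    ultimately obtain c where c: "c \<in> S" "\<And>t. t \<in> S \<Longrightarrow> t \<le> c"
      by (meson compact_attains_sup)
    have "c < b" "a \<le> c"
      using c(1) neg by (auto simp: S_def order.order_iff_strict)
    have "(g has_real_derivative f' c - k) (at c within {c..})"
      unfolding g_def using \<open>c < b\<close> \<open>a \<le> c\<close> by (auto intro!: derivative_eq_intros der)
    moreover have "f' c - k < 0"
      using nonpos[of c] \<open>c < b\<close> \<open>a \<le> c\<close> k by linarith
    ultimately obtain d where d: "d > 0" "\<And>h. 0 < h \<Longrightarrow> c + h \<in> {c..} \<Longrightarrow> h < d \<Longrightarrow> g (c + h) < g c"
      by (metis has_real_derivative_neg_dec_right)
    define h where "h = min (d / 2) (b - c)"
    have h: "0 < h" "h < d" "c + h \<le> b"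
      using d(1) \<open>c < b\<close> by (auto simp: h_def)
    then have "g (c + h) < g c"
      using d(2) by auto
    then have "c + h \<in> S"
      using h c(1) \<open>a \<le> c\<close> by (auto simp: S_def)
    then show False
      using c(2) h by fastforce
  qed
  then show "f b \<le> f a + e"
    using k by (simp add: g_def)
qed

section \<open>Orbits of a strongly continuous semigroup\<close>

text \<open>The norm is pulled back along \<open>J\<close> from a real inner product space, where
  the Lyapunov functional can be differentiated. Compatibility of \<open>J\<close> with differences
  and real multiples is asked on \<open>X\<close> alone, because weak differentiation is linear only
  where derivatives exist.\<close>

locale hilbert_semigroup =
  fixes X :: "'a::ab_group_add set" and smul :: "complex \<Rightarrow> 'a \<Rightarrow> 'a"
    and J :: "'a \<Rightarrow> 'b::real_inner" and D :: "'a set" and A :: "'a \<Rightarrow> 'a" and U :: "real \<Rightarrow> 'a \<Rightarrow> 'a"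
  assumes X_diff: "x \<in> X \<Longrightarrow> y \<in> X \<Longrightarrow> x - y \<in> X"
    and X_smul: "x \<in> X \<Longrightarrow> smul c x \<in> X"
    and J_diff: "x \<in> X \<Longrightarrow> y \<in> X \<Longrightarrow> J (x - y) = J x - J y"
    and J_smul: "x \<in> X \<Longrightarrow> J (smul (of_real r) x) = r *\<^sub>R J x"
    and generates: "generates X smul (\<lambda>x. norm (J x)) D A U"
begin

lemma semigroup: "C0_semigroup X smul (\<lambda>x. norm (J x)) U"
  and graph: "generator_graph X smul (\<lambda>x. norm (J x)) U = {(x, A x) | x. x \<in> D}"
  using generates by (auto simp: generates_def)

lemma U_in: "t \<ge> 0 \<Longrightarrow> x \<in> X \<Longrightarrow> U t x \<in> X"
  and U_smul: "t \<ge> 0 \<Longrightarrow> x \<in> X \<Longrightarrow> U t (smul c x) = smul c (U t x)"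
  and U_0: "x \<in> X \<Longrightarrow> U 0 x = x"
  and U_add_time: "s \<ge> 0 \<Longrightarrow> t \<ge> 0 \<Longrightarrow> x \<in> X \<Longrightarrow> U (s + t) x = U s (U t x)"
  and U_tendsto: "x \<in> X \<Longrightarrow> ((\<lambda>t. norm (J (U t x - x))) \<longlongrightarrow> 0) (at_right 0)"
  using semigroup by (auto simp: C0_semigroup_def bounded_operator_def)

lemma U_add: "t \<ge> 0 \<Longrightarrow> x \<in> X \<Longrightarrow> y \<in> X \<Longrightarrow> U t (x + y) = U t x + U t y"
  using semigroup by (auto simp: C0_semigroup_def bounded_operator_def)

lemma U_diff: "t \<ge> 0 \<Longrightarrow> x \<in> X \<Longrightarrow> y \<in> X \<Longrightarrow> U t (x - y) = U t x - U t y"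
  using U_add[of t "x - y" y] X_diff[of x y] by simp

lemma U_bounded:
  assumes "t \<ge> 0"
  obtains K where "K \<ge> 0" "\<And>x. x \<in> X \<Longrightarrow> norm (J (U t x)) \<le> K * norm (J x)"
proof -
  obtain K where K: "\<forall>x\<in>X. norm (J (U t x)) \<le> K * norm (J x)"
    using semigroup assms unfolding C0_semigroup_def bounded_operator_def by meson
  show thesis
  proof (rule that[of "max 0 K"])
    fix x assume "x \<in> X"
    then have "norm (J (U t x)) \<le> K * norm (J x)" using K by blast
    also have "\<dots> \<le> max 0 K * norm (J x)" by (intro mult_right_mono) auto
    finally show "norm (J (U t x)) \<le> max 0 K * norm (J x)" .
  qed simp
qed

lemma right_continuous:
  assumes "t \<ge> 0" "x \<in> X"
  shows "((\<lambda>s. J (U s x)) \<longlongrightarrow> J (U t x)) (at_right t)"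
proof -
  have "((\<lambda>h. norm (J (U h (U t x) - U t x))) \<longlongrightarrow> 0) (at_right 0)"
    using assms by (intro U_tendsto U_in)
  then have "((\<lambda>h. norm (J (U (h + t) x) - J (U t x))) \<longlongrightarrow> 0) (at_right 0)"
  proof (rule Lim_transform_eventually)
    show "\<forall>\<^sub>F h in at_right 0. norm (J (U h (U t x) - U t x)) = norm (J (U (h + t) x) - J (U t x))"
      using assms by (auto simp: eventually_at_filter U_add_time U_in J_diff)
  qed
  then show ?thesis
    by (subst filterlim_at_right_to_0, subst LIM_zero_iff[symmetric], subst tendsto_norm_zero_iff[symmetric])
qed

text \<open>\<open>U t\<close> commutes with the difference quotient at time 0 and is bounded, so it
  carries the limit \<open>A x\<close> to a limit \<open>U t (A x)\<close> for the orbit that starts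
  at \<open>U t x\<close>.\<close>

lemma generator_invariant:
  assumes "x \<in> D" "t \<ge> 0"
  shows "U t x \<in> D"
proof -
  have "(x, A x) \<in> generator_graph X smul (\<lambda>x. norm (J x)) U"
    using assms graph by auto
  then have x: "x \<in> X" "A x \<in> X"
    and lim: "((\<lambda>h. norm (J (smul (of_real (1 / h)) (U h x - x) - A x))) \<longlongrightarrow> 0) (at_right 0)"
    by (auto simp: generator_graph_def)
  obtain K where K: "\<And>x. x \<in> X \<Longrightarrow> norm (J (U t x)) \<le> K * norm (J x)"
    using U_bounded[OF \<open>t \<ge> 0\<close>] by metis
  have "((\<lambda>h. norm (J (smul (of_real (1 / h)) (U h (U t x) - U t x) - U t (A x)))) \<longlongrightarrow> 0) (at_right 0)"
  proof (rule tendsto_0_le[OF lim])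
    have "norm (J (smul (of_real (1 / h)) (U h (U t x) - U t x) - U t (A x)))
        \<le> norm (J (smul (of_real (1 / h)) (U h x - x) - A x)) * K" if "h > 0" for h
    proof -
      have "U h (U t x) = U t (U h x)"
        using that assms x by (metis U_add_time add.commute less_imp_le)
      then have "smul (of_real (1 / h)) (U h (U t x) - U t x) - U t (A x)
          = U t (smul (of_real (1 / h)) (U h x - x) - A x)"
        using that assms x by (simp add: U_diff U_smul U_in X_diff X_smul)
      then show ?thesis
        using K[of "smul (of_real (1 / h)) (U h x - x) - A x"] that x
        by (simp add: U_in X_diff X_smul mult.commute)
    qed
    then show "\<forall>\<^sub>F h in at_right 0. norm (norm (J (smul (of_real (1 / h)) (U h (U t x) - U t x) - U t (A x))))
        \<le> norm (norm (J (smul (of_real (1 / h)) (U h x - x) - A x))) * K"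
      by (auto simp: eventually_at_filter)
  qed
  then have "(U t x, U t (A x)) \<in> generator_graph X smul (\<lambda>x. norm (J x)) U"
    using assms x by (auto simp: generator_graph_def U_in)
  then show ?thesis
    using graph by auto
qed

text \<open>By the semigroup law the quotient at time \<open>t\<close> is the quotient at time 0 for
  the starting point \<open>U t x\<close>, which again lies in \<open>D\<close>.\<close>

lemma right_derivative:
  assumes "x \<in> D" "t \<ge> 0"
  shows "((\<lambda>s. J (U s x)) has_vector_derivative J (A (U t x))) (at t within {t..})"
proof -
  have "(x, A x) \<in> generator_graph X smul (\<lambda>x. norm (J x)) U"
    using assms graph by auto
  then have "x \<in> X"
    by (auto simp: generator_graph_def)
  define y where "y = U t x"
  have "y \<in> D"
    unfolding y_def using assms by (rule generator_invariant)
  then have "(y, A y) \<in> generator_graph X smul (\<lambda>x. norm (J x)) U"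
    using graph by auto
  then have y: "y \<in> X" "A y \<in> X"
    and lim: "((\<lambda>h. norm (J (smul (of_real (1 / h)) (U h y - y) - A y))) \<longlongrightarrow> 0) (at_right 0)"
    by (auto simp: generator_graph_def)
  have "((\<lambda>h. norm ((1 / h) *\<^sub>R (J (U (h + t) x) - J (U t x)) - J (A y))) \<longlongrightarrow> 0) (at_right 0)"
    using lim
  proof (rule Lim_transform_eventually)
    have "norm (J (smul (of_real (1 / h)) (U h y - y) - A y))
        = norm ((1 / h) *\<^sub>R (J (U (h + t) x) - J (U t x)) - J (A y))" if "h > 0" for h
    proof -
      have "U (h + t) x = U h y"
        using that assms \<open>x \<in> X\<close> by (simp add: U_add_time y_def)
      then show ?thesis
        using that y by (simp add: J_diff J_smul U_in X_diff X_smul y_def[symmetric] del: of_real_divide)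
    qed
    then show "\<forall>\<^sub>F h in at_right 0. norm (J (smul (of_real (1 / h)) (U h y - y) - A y))
        = norm ((1 / h) *\<^sub>R (J (U (h + t) x) - J (U t x)) - J (A y))"
      by (auto simp: eventually_at_filter)
  qed
  then have "((\<lambda>h. (1 / h) *\<^sub>R (J (U (h + t) x) - J (U t x)) - J (A y)) \<longlongrightarrow> 0) (at_right 0)"
    by (simp add: tendsto_norm_zero_iff)
  then have "((\<lambda>s. (1 / (s - t)) *\<^sub>R (J (U s x) - J (U t x)) - J (A y)) \<longlongrightarrow> 0) (at_right t)"
    by (subst filterlim_at_right_to_0) simp
  then have "((\<lambda>s. (1 / norm (s - t)) *\<^sub>R (J (U s x) - (J (U t x) + (s - t) *\<^sub>R J (A y)))) \<longlongrightarrow> 0) (at_right t)"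
  proof (rule Lim_transform_eventually)
    show "\<forall>\<^sub>F s in at_right t. (1 / (s - t)) *\<^sub>R (J (U s x) - J (U t x)) - J (A y)
        = (1 / norm (s - t)) *\<^sub>R (J (U s x) - (J (U t x) + (s - t) *\<^sub>R J (A y)))"
      by (auto simp: eventually_at_filter diff_diff_eq[symmetric] scaleR_diff_right[of _ _ "(_ - t) *\<^sub>R J (A y)"])
  qed
  then show ?thesis
    by (simp add: has_vector_derivative_def has_derivative_within at_within_Ici_at_right
        bounded_linear_scaleR_left y_def)
qed

text \<open>
  Completeness of \<open>X\<close> is not available, so Banach--Steinhaus is replaced by Baire's theorem in
  the time variable: by right continuity of orbits, a uniform bound on a set of times extends to
  the interior of its closure.
\<close>

lemma bounded_on_some_interval:
  assumes "0 \<le> a" "a < b"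
  obtains c d K where "a \<le> c" "c < d" "d \<le> b"
    "\<And>t x. c < t \<Longrightarrow> t < d \<Longrightarrow> x \<in> X \<Longrightarrow> norm (J (U t x)) \<le> K * norm (J x)"
proof -
  \<comment> \<open>Each \<open>U t\<close> is bounded, so these sets exhaust the interval; Baire's
    theorem then gives one whose closure has interior points.\<close>
  define F where "F n = {t \<in> {a<..<b}. \<forall>x\<in>X. norm (J (U t x)) \<le> real n * norm (J x)}" for n :: nat
  have "\<exists>n. interior (closure (F n)) \<noteq> {}"
  proof (rule ccontr)
    assume "\<not> ?thesis"
    then have "closure (- closure (F n)) = UNIV" for n
      by (simp add: closure_complement)
    then have "UNIV \<subseteq> closure (\<Inter>n. - closure (F n))"
      by (intro Baire) auto
    then have "(a + b) / 2 \<in> closure (\<Inter>n. - closure (F n))"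
      by blast
    moreover have "open {a<..<b}" "(a + b) / 2 \<in> {a<..<b}"
      using assms by auto
    ultimately have "(\<Inter>n. - closure (F n)) \<inter> {a<..<b} \<noteq> {}"
      by (meson closure_iff_nhds_not_empty subset_refl)
    then obtain t where t: "t \<in> {a<..<b}" "\<And>n. t \<notin> closure (F n)"
      by blast
    obtain K where K: "\<And>x. x \<in> X \<Longrightarrow> norm (J (U t x)) \<le> K * norm (J x)"
      using U_bounded[of t] t(1) assms by (metis greaterThanLessThan_iff less_eq_real_def order_trans)
    obtain n where "K \<le> real n"
      using real_arch_simple by blast
    then have "t \<in> F n"
      using t K unfolding F_def by (auto intro: order_trans[OF K mult_right_mono])
    then show False
      using t closure_subset by blast
  qed
  then obtain n t0 where t0: "t0 \<in> interior (closure (F n))"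
    by blast
  then obtain e where e: "e > 0" "ball t0 e \<subseteq> closure (F n)"
    by (meson mem_interior)
  define c d where "c = t0 - e" and "d = t0 + e"
  have cd: "{c<..<d} \<subseteq> closure (F n)"
    using e by (simp add: c_def d_def ball_eq_greaterThanLessThan)
  have "closure (F n) \<subseteq> {a..b}"
    by (intro closure_minimal) (auto simp: F_def)
  then have sub: "{c<..<d} \<subseteq> {a..b}"
    using cd by blast
  have "c < d"
    using e by (simp add: c_def d_def)
  then have "closure {c<..<d} \<subseteq> {a..b}"
    using sub by (intro closure_minimal) auto
  then have ab: "a \<le> c" "d \<le> b"
    using \<open>c < d\<close> by auto
  show thesis
  proof (rule that[OF ab(1) \<open>c < d\<close> ab(2)])
    fix t x assume t: "c < t" "t < d" and x: "x \<in> X"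
    show "norm (J (U t x)) \<le> real n * norm (J x)"
    \<comment> \<open>By right continuity a violation at \<open>t\<close> persists on an interval to
      its right, where \<open>F n\<close> is dense.\<close>
    proof (rule ccontr)
      assume "\<not> ?thesis"
      moreover have "((\<lambda>s. norm (J (U s x))) \<longlongrightarrow> norm (J (U t x))) (at_right t)"
        using assms ab t x by (intro tendsto_norm right_continuous) auto
      ultimately have "\<forall>\<^sub>F s in at_right t. norm (J (U s x)) > real n * norm (J x)"
        by (intro order_tendstoD) auto
      then obtain r where r: "r > t" "\<And>s. t < s \<Longrightarrow> s < r \<Longrightarrow> norm (J (U s x)) > real n * norm (J x)"
        unfolding eventually_at_right_field by blast
      have "open {t<..<min r d}" "(t + min r d) / 2 \<in> {t<..<min r d}"
        using r t by (auto simp: min_def)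
      moreover have "(t + min r d) / 2 \<in> closure (F n)"
        using cd r t by (force simp: min_def)
      ultimately have "F n \<inter> {t<..<min r d} \<noteq> {}"
        by (meson closure_iff_nhds_not_empty subset_refl)
      then obtain s where "s \<in> F n" "s \<in> {t<..<min r d}"
        by blast
      then show False
        using r(2)[of s] x by (auto simp: F_def not_less[symmetric])
    qed
  qed
qed

text \<open>Left continuity at \<open>t\<close> requires a bound on \<open>U (t - h)\<close> that is
  uniform for small \<open>h\<close>. It comes from factoring out a fixed operator
  \<open>U r\<close> and letting the remaining time vary in an interval of uniform
  boundedness.\<close>

lemma continuous_orbit:
  assumes "x \<in> X"
  shows "continuous_on {0..} (\<lambda>t. J (U t x))"
proof -
  have left: "((\<lambda>s. J (U s x)) \<longlongrightarrow> J (U t x)) (at_left t)" if "t > 0" for t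
  proof -
    obtain c d K where c: "0 \<le> c" "c < d" "d \<le> t"
      and K: "\<And>t x. c < t \<Longrightarrow> t < d \<Longrightarrow> x \<in> X \<Longrightarrow> norm (J (U t x)) \<le> K * norm (J x)"
      using bounded_on_some_interval[of 0 t] \<open>t > 0\<close> by auto
    \<comment> \<open>The remaining time \<open>t - h - r\<close> equals
      \<open>(c + d) / 2 - h\<close>, which stays in the interval from \<open>c\<close> to
      \<open>d\<close> as long as \<open>h < (d - c) / 2\<close>.\<close>
    define r where "r = t - (c + d) / 2"
    have "r \<ge> 0"
      using c by (simp add: r_def)
    then obtain K' where K': "K' \<ge> 0" "\<And>x. x \<in> X \<Longrightarrow> norm (J (U r x)) \<le> K' * norm (J x)"
      using U_bounded[of r] by metis
    have bound: "norm (J (U (t - h) x) - J (U t x)) \<le> norm (J (U h x - x)) * (K' * K)"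
      if h: "0 < h" "h < (d - c) / 2" for h
    proof -
      have x': "U h x - x \<in> X"
        using assms h by (simp add: X_diff U_in)
      have th: "t - h = r + (t - h - r)" "c < t - h - r" "t - h - r < d"
        using h c by (auto simp: r_def field_simps)
      have "J (U t x) - J (U (t - h) x) = J (U (t - h) (U h x - x))"
        using U_add_time[of "t - h" h x] th h assms c \<open>r \<ge> 0\<close>
        by (simp add: U_diff U_in J_diff)
      also have "\<dots> = J (U r (U (t - h - r) (U h x - x)))"
        using U_add_time[of r "t - h - r" "U h x - x"] th x' \<open>r \<ge> 0\<close> c by simp
      finally have "norm (J (U t x) - J (U (t - h) x)) \<le> K' * norm (J (U (t - h - r) (U h x - x)))"
        using K'(2) x' U_in th c by (metis dual_order.trans less_imp_le)
      also have "\<dots> \<le> K' * (K * norm (J (U h x - x)))"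
        using K' K x' th by (intro mult_left_mono) auto
      finally show ?thesis
        by (simp add: norm_minus_commute mult_ac)
    qed
    have "((\<lambda>h. J (U (t - h) x) - J (U t x)) \<longlongrightarrow> 0) (at_right 0)"
    proof (rule tendsto_0_le[OF U_tendsto[OF assms]])
      show "\<forall>\<^sub>F h in at_right 0. norm (J (U (t - h) x) - J (U t x)) \<le> norm (norm (J (U h x - x))) * (K' * K)"
        unfolding eventually_at_right_field using bound c by (intro exI[of _ "(d - c) / 2"]) auto
    qed
    then have "((\<lambda>s. J (U s x) - J (U t x)) \<longlongrightarrow> 0) (at_left t)"
      by (simp add: at_left_minus[of t] filterlim_filtermap filterlim_at_right_to_0[of _ _ "- t"])
    then show ?thesis
      by (simp add: LIM_zero_iff)
  qed
  show ?thesis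
    unfolding continuous_on_def
  proof
    fix t :: real assume "t \<in> {0..}"
    show "((\<lambda>s. J (U s x)) \<longlongrightarrow> J (U t x)) (at t within {0..})"
    proof (cases "t = 0")
      case True
      then show ?thesis
        using right_continuous[of 0 x] assms by (simp add: at_within_Ici_at_right)
    next
      case False
      then have "((\<lambda>s. J (U s x)) \<longlongrightarrow> J (U t x)) (at t)"
        using left[of t] right_continuous[of t x] assms \<open>t \<in> {0..}\<close> by (simp add: filterlim_at_split)
      then show ?thesis
        by (rule tendsto_within_subset) simp
    qed
  qed
qed

text \<open>The functional \<open>q\<close> satisfies \<open>q' \<le> - (\<omega> / M) * q\<close>,
  so its product with \<open>exp (\<omega> / M * s)\<close> decreases. Coercivity returns to the
  norm, and the square root halves the rate. The decay hypothesis carries both terms of the product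
  rule because \<open>P\<close> need not be symmetric.\<close>

theorem lyapunov_exponential_decay:
  assumes P: "bounded_linear P"
    and coercive: "\<And>u. m * (norm u)\<^sup>2 \<le> inner u (P u)" "m > 0"
    and bounded: "\<And>u. inner u (P u) \<le> M * (norm u)\<^sup>2" "M > 0"
    and decay: "\<And>x. x \<in> D \<Longrightarrow> inner (J (A x)) (P (J x)) + inner (J x) (P (J (A x))) \<le> - \<omega> * (norm (J x))\<^sup>2"
      "\<omega> > 0"
    and dense: "\<And>x e. x \<in> X \<Longrightarrow> e > 0 \<Longrightarrow> \<exists>y\<in>D. norm (J (x - y)) < e"
    and "t \<ge> 0" "x \<in> X"
  shows "norm (J (U t x)) \<le> sqrt (M / m) * exp (- (\<omega> / (2 * M)) * t) * norm (J x)"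
proof -
  define k where "k = sqrt (M / m) * exp (- (\<omega> / (2 * M)) * t)"
  have "k \<ge> 0"
    using coercive bounded by (simp add: k_def)
  have D_X: "D \<subseteq> X"
    using graph by (auto simp: generator_graph_def)
  have on_D: "norm (J (U t x)) \<le> k * norm (J x)" if "x \<in> D" for x
  proof -
    define q where "q s = inner (J (U s x)) (P (J (U s x)))" for s
    define q' where "q' s = inner (J (U s x)) (P (J (A (U s x)))) + inner (J (A (U s x))) (P (J (U s x)))" for s
    define c where "c = \<omega> / M"
    have "c > 0"
      using bounded decay by (simp add: c_def)
    have contJ: "continuous_on {0..t} (\<lambda>s. J (U s x))"
      by (rule continuous_on_subset[OF continuous_orbit]) (use that D_X in auto)
    have "continuous_on {0..t} q"
      unfolding q_def by (intro continuous_on_inner contJ bounded_linear.continuous_on[OF P])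
    then have cont: "continuous_on {0..t} (\<lambda>s. exp (c * s) * q s)"
      by (intro continuous_intros)
    have der: "((\<lambda>s. exp (c * s) * q s) has_real_derivative (c * q s + q' s) * exp (c * s)) (at s within {s..})"
      if s: "0 \<le> s" for s
    proof -
      have J': "((\<lambda>s. J (U s x)) has_vector_derivative J (A (U s x))) (at s within {s..})"
        using \<open>x \<in> D\<close> s by (rule right_derivative)
      have "(q has_real_derivative q' s) (at s within {s..})"
        using has_derivative_inner[OF J'[unfolded has_vector_derivative_def]
            bounded_linear.has_derivative[OF P J'[unfolded has_vector_derivative_def]]]
        unfolding q_def q'_def has_field_derivative_def
        by (rule has_derivative_eq_rhs)
           (auto simp: bounded_linear.linear[OF P] linear_simps[OF P] algebra_simps)
      then show ?thesis
        by (auto intro!: derivative_eq_intros simp: algebra_simps)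
    qed
    have nonpos: "(c * q s + q' s) * exp (c * s) \<le> 0" if s: "0 \<le> s" for s
    proof -
      have "q' s \<le> - \<omega> * (norm (J (U s x)))\<^sup>2"
        using decay(1)[OF generator_invariant[OF \<open>x \<in> D\<close> s]] by (simp add: q'_def)
      moreover have "c * q s \<le> c * (M * (norm (J (U s x)))\<^sup>2)"
        unfolding q_def using \<open>c > 0\<close> bounded by (intro mult_left_mono) auto
      moreover have "c * M = \<omega>"
        using bounded by (simp add: c_def)
      ultimately have "c * q s + q' s \<le> 0"
        by (simp add: mult.assoc[symmetric])
      then show ?thesis
        by (simp add: mult_nonpos_nonneg)
    qed
    have "exp (c * t) * q t \<le> exp (c * 0) * q 0"
      by (rule antimono_of_right_derivative_nonpos[OF \<open>t \<ge> 0\<close> cont der nonpos])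
    then have "q t \<le> exp (- c * t) * q 0"
      by (simp add: exp_minus field_simps)
    moreover have "q 0 \<le> M * (norm (J x))\<^sup>2"
      using bounded(1)[of "J x"] U_0[of x] that D_X by (auto simp: q_def)
    then have "exp (- c * t) * q 0 \<le> exp (- c * t) * (M * (norm (J x))\<^sup>2)"
      by (intro mult_left_mono) auto
    moreover have "m * (norm (J (U t x)))\<^sup>2 \<le> q t"
      using coercive by (simp add: q_def)
    ultimately have "m * (norm (J (U t x)))\<^sup>2 \<le> exp (- c * t) * (M * (norm (J x))\<^sup>2)"
      by linarith
    then have "(norm (J (U t x)))\<^sup>2 \<le> M / m * exp (- c * t) * (norm (J x))\<^sup>2"
      using coercive by (simp add: field_simps)
    also have "\<dots> = (k * norm (J x))\<^sup>2"
      using coercive bounded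
      by (simp add: k_def power_mult_distrib c_def exp_double[symmetric] real_sqrt_pow2)
    finally show ?thesis
      by (rule power2_le_imp_le) (use \<open>k \<ge> 0\<close> in auto)
  qed
  obtain K where K: "K \<ge> 0" "\<And>x. x \<in> X \<Longrightarrow> norm (J (U t x)) \<le> K * norm (J x)"
    using U_bounded[OF \<open>t \<ge> 0\<close>] by metis
  have "norm (J (U t x)) \<le> k * norm (J x)"
  proof (rule field_le_epsilon)
    fix e :: real assume "e > 0"
    \<comment> \<open>Replacing \<open>x\<close> by \<open>y\<close> costs at most
      \<open>(K + k) * r\<close>, with \<open>K\<close> a bound for this one time \<open>t\<close>;
      the summand 1 keeps the denominator positive.\<close>
    define r where "r = e / (K + k + 1)"
    have r: "r > 0" "(K + k) * r \<le> e"
      using \<open>e > 0\<close> \<open>k \<ge> 0\<close> K(1) by (auto simp: r_def field_simps)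
    obtain y where y: "y \<in> D" "norm (J (x - y)) < r"
      using dense[OF \<open>x \<in> X\<close> r(1)] by blast
    have yX: "y \<in> X" "x - y \<in> X"
      using y D_X \<open>x \<in> X\<close> X_diff by auto
    have "J (U t x) = J (U t (x - y)) + J (U t y)"
      using \<open>t \<ge> 0\<close> \<open>x \<in> X\<close> yX by (simp add: U_diff J_diff U_in)
    then have "norm (J (U t x)) \<le> norm (J (U t (x - y))) + norm (J (U t y))"
      by (simp add: norm_triangle_ineq)
    also have "\<dots> \<le> K * norm (J (x - y)) + k * norm (J y)"
      using K(2) yX on_D y by (intro add_mono) auto
    also have "norm (J y) \<le> norm (J x) + norm (J (x - y))"
      using norm_triangle_ineq4[of "J x" "J (x - y)"] \<open>x \<in> X\<close> yX by (simp add: J_diff)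
    then have "K * norm (J (x - y)) + k * norm (J y) \<le> K * r + k * (norm (J x) + r)"
      using y K \<open>k \<ge> 0\<close> by (intro add_mono mult_left_mono) auto
    also have "\<dots> \<le> k * norm (J x) + e"
      using r by (simp add: algebra_simps)
    finally show "norm (J (U t x)) \<le> k * norm (J x) + e" .
  qed
  then show ?thesis
    by (simp add: k_def)
qed

end

section \<open>The beam\<close>

text \<open>Pointwise, \<open>F\<close> is bounded by the integral of \<open>cmod (f r)\<close>,
  which Cauchy-Schwarz against the constant 1 bounds by the L2 norm. An approximation of w''
  therefore controls w' as well.\<close>

lemma norm_primitive_le:
  assumes "primitive F f" "F 0 = 0"
  shows "norm (abs_L2 F) \<le> norm (abs_L2 f)"
proof (rule norm_abs_L2_le)
  note sq = primitive_square_integrable[OF assms(1)]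
  show "square_integrable F" by fact
  show "0 \<le> norm (abs_L2 f)" by simp
  fix s :: real assume s: "0 < s" "s < 1"
  have one: "square_integrable (\<lambda>s. 1)"
    by (intro square_integrable_continuous continuous_intros)
  have abs_f: "square_integrable (\<lambda>s. of_real (cmod (f s)))"
  proof (rule square_integrable_bound[OF sq(2)])
    have [measurable]: "f \<in> borel_measurable unit_interval"
      using sq(2) by (rule square_integrable_measurable)
    show "(\<lambda>s. complex_of_real (cmod (f s))) \<in> borel_measurable unit_interval"
      by measurable
  qed simp
  have "F s = (LINT r|unit_interval. indicat_real {0<..<s} r *\<^sub>R f r)"
    using primitive_set_integral[OF assms(1), of s] s assms(2) by (simp add: set_lebesgue_integral_def)
  also have "cmod \<dots> \<le> (LINT r|unit_interval. cmod (indicat_real {0<..<s} r *\<^sub>R f r))"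
    by (rule integral_norm_bound)
  also have "\<dots> \<le> (LINT r|unit_interval. cmod (f r))"
  proof (rule integral_mono)
    show "integrable unit_interval (\<lambda>r. cmod (f r))"
      using square_integrable_integrable[OF sq(2)] by (rule integrable_norm)
    show "integrable unit_interval (\<lambda>r. cmod (indicat_real {0<..<s} r *\<^sub>R f r))"
      using s by (intro integrable_norm integrable_mult_indicator square_integrable_integrable[OF sq(2)])
        (auto simp: sets_restrict_space_iff)
  qed (simp add: indicator_def)
  also have "\<dots> = inner (abs_L2 (\<lambda>s. of_real (cmod (f s)))) (abs_L2 (\<lambda>s. 1))"
    using one abs_f by (simp add: inner_abs_L2)
  also have "\<dots> \<le> norm (abs_L2 (\<lambda>s. of_real (cmod (f s)))) * norm (abs_L2 (\<lambda>s. 1))"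
    by (rule norm_cauchy_schwarz)
  also have "\<dots> = norm (abs_L2 f)"
    using one abs_f sq(2) by (simp add: norm_abs_L2)
  finally show "cmod (F s) \<le> norm (abs_L2 f)" .
qed

lemma polynomial_function_square_integrable: "polynomial_function p \<Longrightarrow> square_integrable p"
  by (intro square_integrable_continuous continuous_on_polymonial_function)

lemma polynomial_function_primitive:
  assumes "polynomial_function p"
  obtains p' where "polynomial_function p'" "\<And>s. (p has_vector_derivative p' s) (at s)" "primitive p p'"
  using has_vector_derivative_polynomial_function[OF assms]
  by (metis continuous_on_polymonial_function primitive_of_derivative)

lemma polynomial_function_power [intro]:
  "polynomial_function (f :: real \<Rightarrow> real) \<Longrightarrow> polynomial_function (\<lambda>s. f s ^ n)"
  unfolding real_polynomial_function_eq[symmetric] by (rule real_polynomial_function_power)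

text \<open>Serves correctors such as \<open>s ^ Suc n\<close>, which keep fixed data at an endpoint
  while dying out inside. The coefficient may depend on \<open>n\<close>, as the slope corrector
  requires.\<close>

lemma scaled_corrector_tendsto_zero:
  fixes \<phi> :: "nat \<Rightarrow> real \<Rightarrow> real" and c :: "nat \<Rightarrow> complex"
  assumes poly: "\<And>n. polynomial_function (\<phi> n)"
    and bound: "\<And>n s. 0 < s \<Longrightarrow> s < 1 \<Longrightarrow> \<bar>\<phi> n s\<bar> \<le> 1"
    and lim: "\<And>s. 0 < s \<Longrightarrow> s < 1 \<Longrightarrow> (\<lambda>n. \<phi> n s) \<longlonglongrightarrow> 0"
    and c: "\<And>n. cmod (c n) \<le> C"
  shows "(\<lambda>n. norm (abs_L2 (\<lambda>s. \<phi> n s *\<^sub>R c n))) \<longlonglongrightarrow> 0"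
proof (rule tendsto_norm_abs_L2_dominated[where g = "\<lambda>s. C"])
  have "0 \<le> C"
    using c[of 0] norm_ge_zero order_trans by blast
  show "square_integrable (\<lambda>s. \<phi> n s *\<^sub>R c n)" for n
    by (intro polynomial_function_square_integrable polynomial_function_mult poly polynomial_function_const)
  show "cmod (\<phi> n s *\<^sub>R c n) \<le> C" if "0 < s" "s < 1" for n s
    using mult_mono[OF bound[OF that, of n] c[of n]] by simp
  show "AE s in unit_interval. (\<lambda>n. \<phi> n s *\<^sub>R c n) \<longlonglongrightarrow> 0"
  proof (rule AE_I2)
    fix s assume "s \<in> space unit_interval"
    then have "(\<lambda>n. \<bar>\<phi> n s\<bar> * C) \<longlonglongrightarrow> 0"
      using tendsto_mult[OF tendsto_rabs[OF lim] tendsto_const] by simp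
    then show "(\<lambda>n. \<phi> n s *\<^sub>R c n) \<longlonglongrightarrow> 0"
      by (rule Lim_null_comparison[rotated]) (auto intro!: always_eventually mult_left_mono c)
  qed
qed simp

text \<open>The L2 norm does not see point values: high powers of \<open>s\<close> and of
  \<open>1 - s\<close> repair the values at 1 and at 0. The exponent is \<open>Suc n\<close>, so
  that each corrector vanishes at the opposite endpoint even for \<open>n = 0\<close>.\<close>

lemma polynomial_function_dense_L2_boundary_values:
  assumes g: "square_integrable g" and "e > 0"
  obtains p where "polynomial_function p" "p 0 = 0" "p 1 = b" "norm (abs_L2 g - abs_L2 p) < e"
proof -
  obtain q where q: "polynomial_function q" "norm (abs_L2 g - abs_L2 q) < e / 2"
    using polynomial_function_dense_L2[OF g, of "e / 2"] \<open>e > 0\<close> by auto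
  define x y where "x n = abs_L2 (\<lambda>s. s ^ Suc n *\<^sub>R (b - q 1))"
    and "y n = abs_L2 (\<lambda>s. (1 - s) ^ Suc n *\<^sub>R q 0)" for n
  have x: "(\<lambda>n. norm (x n)) \<longlonglongrightarrow> 0"
    unfolding x_def
    by (rule scaled_corrector_tendsto_zero)
       (auto intro!: polynomial_function_power power_le_one LIMSEQ_Suc[OF LIMSEQ_realpow_zero] simp del: power_Suc)
  have y: "(\<lambda>n. norm (y n)) \<longlonglongrightarrow> 0"
    unfolding y_def
    by (rule scaled_corrector_tendsto_zero)
       (auto intro!: polynomial_function_power power_le_one LIMSEQ_Suc[OF LIMSEQ_realpow_zero] simp del: power_Suc)
  have "(\<lambda>n. norm (x n) + norm (y n)) \<longlonglongrightarrow> 0"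
    using tendsto_add[OF x y] by simp
  then have "\<forall>\<^sub>F n in sequentially. norm (x n) + norm (y n) < e / 2"
    using \<open>e > 0\<close> by (intro order_tendstoD) auto
  then obtain n where n: "norm (x n) + norm (y n) < e / 2"
    using eventually_happens'[OF sequentially_bot] by blast
  define p where "p s = q s + s ^ Suc n *\<^sub>R (b - q 1) - (1 - s) ^ Suc n *\<^sub>R q 0" for s :: real
  have poly: "polynomial_function (\<lambda>s. s ^ Suc n *\<^sub>R (b - q 1))" "polynomial_function (\<lambda>s. (1 - s) ^ Suc n *\<^sub>R q 0)"
    by (intro polynomial_function_mult polynomial_function_power polynomial_function_diff
        polynomial_function_id polynomial_function_const)+
  have p: "polynomial_function p"
    unfolding p_def by (intro polynomial_function_diff polynomial_function_add q poly)
  have p_eq: "abs_L2 p = abs_L2 q + x n - y n"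
    unfolding p_def x_def y_def using q poly
    by (simp add: abs_L2_simps polynomial_function_square_integrable square_integrable_add del: power_Suc)
  have "norm (abs_L2 g - abs_L2 p) = norm ((abs_L2 g - abs_L2 q) + (y n - x n))"
    unfolding p_eq by (simp add: algebra_simps)
  also have "\<dots> < e"
    using norm_triangle_ineq[of "abs_L2 g - abs_L2 q" "y n - x n"] norm_triangle_ineq4[of "y n" "x n"] n q(2)
    by linarith
  finally have "norm (abs_L2 g - abs_L2 p) < e" .
  moreover have "p 0 = 0" "p 1 = b"
    by (auto simp: p_def)
  ultimately show thesis
    using that[OF p] by blast
qed

text \<open>
  Adding a multiple of \<open>s\<^sup>n (1 - s)\<close>, which is small in $L_2(0,1)$, adjusts the slope at \<open>1\<close>
  without changing the boundary values.
\<close>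

lemma polynomial_function_dense_L2_boundary_slope:
  fixes a :: real
  assumes g: "square_integrable g" and "e > 0" "a > 0"
  obtains p p' where "polynomial_function p" "polynomial_function p'"
    "\<And>s. (p has_vector_derivative p' s) (at s)"
    "p 0 = 0" "p 1 = b" "p' 1 = a *\<^sub>R (c + (LINT s|unit_interval. p s))" "norm (abs_L2 g - abs_L2 p) < e"
proof -
  obtain q where q: "polynomial_function q" "q 0 = 0" "q 1 = b" "norm (abs_L2 g - abs_L2 q) < e / 2"
    using polynomial_function_dense_L2_boundary_values[OF g, of "e / 2"] \<open>e > 0\<close> by auto
  obtain q' where q': "\<And>s. (q has_vector_derivative q' s) (at s)"
    using polynomial_function_primitive[OF q(1)] by metis
  define \<phi> where "\<phi> n s = s ^ Suc n * (1 - s)" for n and s :: real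
  \<comment> \<open>Here \<open>p\<close> stands for w'' and \<open>c\<close> for w'(0), so
    \<open>c\<close> plus the integral of \<open>p\<close> is w'(1), and the required slope is the
    condition w'''(1) = a w'(1). \<open>K\<close> is the amount by which \<open>q\<close> misses
    it.\<close>
  define K where "K = a *\<^sub>R (c + (LINT s|unit_interval. q s)) - q' 1"
  define I where "I n = (LINT s|unit_interval. \<phi> n s)" for n
  \<comment> \<open>Subtracting \<open>\<phi> n s *\<^sub>R \<mu> n\<close> raises the slope at 1 by
    \<open>\<mu> n\<close>, since \<open>\<phi> n\<close> has slope -1 there, but lowers the
    integral by \<open>I n *\<^sub>R \<mu> n\<close>. Balancing both gives
    \<open>(1 + a * I n) *\<^sub>R \<mu> n = K\<close>, and \<open>I n \<ge> 0\<close> bounds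
    \<open>\<mu> n\<close> by \<open>K\<close>.\<close>
  define \<mu> where "\<mu> n = (1 / (1 + a * I n)) *\<^sub>R K" for n
  have poly: "polynomial_function (\<phi> n)" for n
    unfolding \<phi>_def real_polynomial_function_eq[symmetric]
    by (intro real_polynomial_function.intros(4) real_polynomial_function_power real_polynomial_function_diff)
       (auto simp: real_polynomial_function_eq)
  have \<phi>: "0 \<le> \<phi> n s" "\<phi> n s \<le> 1" if "0 < s" "s < 1" for n s
    using that unfolding \<phi>_def by (auto intro!: mult_le_one power_le_one simp del: power_Suc)
  have I: "I n \<ge> 0" for n
    unfolding I_def by (intro integral_nonneg_AE AE_I2) (use \<phi> in auto)
  have pos: "1 + a * I n > 0" for n
    using I[of n] \<open>a > 0\<close> by (simp add: add_pos_nonneg)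
  have \<mu>_le: "cmod (\<mu> n) \<le> cmod K" for n
  proof -
    have "1 / (1 + a * I n) \<le> 1"
      using I[of n] \<open>a > 0\<close> pos[of n] by simp
    then show ?thesis
      using pos[of n] mult_right_mono[of "1 / (1 + a * I n)" 1 "cmod K"] by (simp add: \<mu>_def)
  qed
  have "(\<lambda>n. norm (abs_L2 (\<lambda>s. \<phi> n s *\<^sub>R \<mu> n))) \<longlonglongrightarrow> 0"
  proof (rule scaled_corrector_tendsto_zero[OF poly _ _ \<mu>_le])
    show "\<bar>\<phi> n s\<bar> \<le> 1" if "0 < s" "s < 1" for n s
      using \<phi>[OF that] by simp
    show "(\<lambda>n. \<phi> n s) \<longlonglongrightarrow> 0" if "0 < s" "s < 1" for s
      unfolding \<phi>_def using that
      by (intro tendsto_mult_left_zero LIMSEQ_Suc[OF LIMSEQ_realpow_zero]) auto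
  qed
  then have "\<forall>\<^sub>F n in sequentially. norm (abs_L2 (\<lambda>s. \<phi> n s *\<^sub>R \<mu> n)) < e / 2"
    using \<open>e > 0\<close> by (intro order_tendstoD) auto
  then obtain n where n: "norm (abs_L2 (\<lambda>s. \<phi> n s *\<^sub>R \<mu> n)) < e / 2"
    using eventually_happens'[OF sequentially_bot] by blast
  define p where "p s = q s - \<phi> n s *\<^sub>R \<mu> n" for s
  have poly_c: "polynomial_function (\<lambda>s. \<phi> n s *\<^sub>R \<mu> n)"
    by (intro polynomial_function_mult poly polynomial_function_const)
  have p: "polynomial_function p"
    unfolding p_def by (intro polynomial_function_diff q poly_c)
  obtain p' where p': "polynomial_function p'" "\<And>s. (p has_vector_derivative p' s) (at s)"
    using polynomial_function_primitive[OF p] by metis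
  have "(\<phi> n has_real_derivative - 1) (at 1)"
    unfolding \<phi>_def by (rule derivative_eq_intros refl | simp)+
  then have "(\<phi> n has_vector_derivative - 1) (at 1)"
    by (simp add: has_real_derivative_iff_has_vector_derivative)
  then have "(p has_vector_derivative q' 1 + \<mu> n) (at 1)"
    unfolding p_def by (auto intro!: derivative_eq_intros q' has_vector_derivative_scaleR[THEN has_vector_derivative_eq_rhs]
        simp: has_real_derivative_iff_has_vector_derivative)
  then have p'1: "p' 1 = q' 1 + \<mu> n"
    using p'(2) vector_derivative_unique_at by blast
  have \<phi>_int: "integrable unit_interval (\<phi> n)"
    using \<phi> by (intro unit_interval.integrable_const_bound[where B = 1] AE_I2
        continuous_imp_measurable_on_sets_lebesgue continuous_on_polymonial_function poly) auto
  have "(LINT s|unit_interval. p s) = (LINT s|unit_interval. q s) - I n *\<^sub>R \<mu> n"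
    unfolding p_def I_def
    using square_integrable_integrable[OF polynomial_function_square_integrable[OF q(1)]]
      \<phi>_int
    by simp
  then have int_p: "a *\<^sub>R (c + (LINT s|unit_interval. p s)) = a *\<^sub>R (c + (LINT s|unit_interval. q s)) - (a * I n) *\<^sub>R \<mu> n"
    by (simp add: scaleR_add_right scaleR_diff_right)
  have "\<mu> n + (a * I n) *\<^sub>R \<mu> n = K"
    using pos[of n] by (simp add: \<mu>_def scaleR_add_left[symmetric] add_divide_distrib[symmetric])
  then have slope: "p' 1 = a *\<^sub>R (c + (LINT s|unit_interval. p s))"
    unfolding p'1 K_def int_p by (simp add: eq_diff_eq add_ac)
  have p_eq: "abs_L2 p = abs_L2 q - abs_L2 (\<lambda>s. \<phi> n s *\<^sub>R \<mu> n)"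
    unfolding p_def using q(1) poly_c by (simp add: abs_L2_simps polynomial_function_square_integrable)
  have "norm (abs_L2 g - abs_L2 p) = norm ((abs_L2 g - abs_L2 q) + abs_L2 (\<lambda>s. \<phi> n s *\<^sub>R \<mu> n))"
    unfolding p_eq by (simp add: algebra_simps)
  also have "\<dots> < e"
    using norm_triangle_ineq[of "abs_L2 g - abs_L2 q" "abs_L2 (\<lambda>s. \<phi> n s *\<^sub>R \<mu> n)"] n q(4)
    by linarith
  finally have "norm (abs_L2 g - abs_L2 p) < e" .
  moreover have "p 0 = 0" "p 1 = b"
    using q by (auto simp: p_def \<phi>_def)
  ultimately show thesis
    using that[OF p p' _ _ slope] by blast
qed

section \<open>The energy space and the domain of the generator\<close>

text \<open>The factor \<open>sqrt a\<close> makes the product norm equal to the energy norm when a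
  = \<gamma> - \<eta>^2. The displacement itself is not recorded, as the energy contains only its
  derivatives.\<close>

definition state_map :: "real \<Rightarrow> L2 \<times> L2 \<Rightarrow> L2 \<times> L2 \<times> L2" where
  "state_map a = (\<lambda>(w, v). (weak_deriv (weak_deriv w), sqrt a *\<^sub>R weak_deriv w, v))"

lemma state_map_primitive:
  "primitive W0 W1 \<Longrightarrow> primitive W1 w2 \<Longrightarrow> state_map a (abs_L2 W0, v) = (abs_L2 w2, sqrt a *\<^sub>R abs_L2 W1, v)"
  by (simp add: state_map_def primitive_weak_deriv)

lemma norm_state_eq:
  assumes "\<gamma> \<ge> \<eta>\<^sup>2"
  shows "norm_state \<gamma> \<eta> x = norm (state_map (\<gamma> - \<eta>\<^sup>2) x)"
proof (cases x)
  case (Pair w v)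
  have n: "Re (inner_L2 f f) = (norm f)\<^sup>2" for f
    by (simp add: power2_norm_eq_inner inner_L2_real_def)
  show ?thesis
    using assms unfolding norm_state_def inner_state_def Pair state_map_def
    by (simp add: norm_Pair n power_mult_distrib numeral_2_eq_2)
qed

lemma state_spaceI:
  assumes "primitive W0 W1" "primitive W1 w2" "W0 0 = 0"
  shows "(abs_L2 W0, v) \<in> state_space"
  using assms sobolev_2I[OF assms(1,2)]
  by (simp add: state_space_def sobolev2_0_def primitive_value_at)

lemma state_spaceE:
  assumes "x \<in> state_space"
  obtains W0 W1 w2 v0 where "primitive W0 W1" "primitive W1 w2" "W0 0 = 0" "square_integrable v0"
    "x = (abs_L2 W0, abs_L2 v0)"
proof -
  obtain w v where x: "x = (w, v)" "w \<in> sobolev 2" "value_at w 0 = 0"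
    using assms by (auto simp: state_space_def sobolev2_0_def)
  obtain W0 W1 w2 where W: "primitive W0 W1" "primitive W1 w2" "w = abs_L2 W0"
    using sobolev_2E[OF x(2)] by metis
  obtain v0 where "square_integrable v0" "v = abs_L2 v0"
    by (rule L2_cases)
  moreover have "W0 0 = 0"
    using x(3) W by (simp add: primitive_value_at)
  ultimately show thesis
    using x W that by blast
qed

lemma primitive_scale:
  assumes "primitive F f"
  shows "primitive (\<lambda>s. c * F s) (\<lambda>s. c * f s)"
  using assms unfolding primitive_iff_has_integral
  by (auto simp: square_integrable_mult right_diff_distrib[symmetric] intro: has_integral_mult_right)

lemma state_space_diff:
  assumes "x \<in> state_space" "y \<in> state_space"
  shows "x - y \<in> state_space" "state_map a (x - y) = state_map a x - state_map a y"
proof -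
  obtain W0 W1 w2 v0 where x: "primitive W0 W1" "primitive W1 w2" "W0 0 = 0" "square_integrable v0"
    "x = (abs_L2 W0, abs_L2 v0)"
    using assms(1) by (rule state_spaceE)
  obtain Y0 Y1 y2 u0 where y: "primitive Y0 Y1" "primitive Y1 y2" "Y0 0 = 0" "square_integrable u0"
    "y = (abs_L2 Y0, abs_L2 u0)"
    using assms(2) by (rule state_spaceE)
  note p = primitive_diff[OF x(1) y(1)] primitive_diff[OF x(2) y(2)]
  note sq = primitive_square_integrable[OF x(1)] primitive_square_integrable[OF x(2)]
    primitive_square_integrable[OF y(1)] primitive_square_integrable[OF y(2)]
  have eq: "x - y = (abs_L2 (\<lambda>s. W0 s - Y0 s), abs_L2 v0 - abs_L2 u0)"
    using sq by (simp add: x(5) y(5) minus_L2.abs_eq)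
  show "x - y \<in> state_space"
    unfolding eq by (rule state_spaceI[OF p]) (simp add: x y)
  show "state_map a (x - y) = state_map a x - state_map a y"
    unfolding eq state_map_primitive[OF p] unfolding x(5) y(5)
    using sq by (simp add: state_map_primitive[OF x(1,2)] state_map_primitive[OF y(1,2)]
        scaleR_diff_right minus_L2.abs_eq[symmetric])
qed

lemma state_space_scale:
  assumes "x \<in> state_space"
  shows "scale_state c x \<in> state_space" "state_map a (scale_state (of_real r) x) = r *\<^sub>R state_map a x"
proof -
  obtain W0 W1 w2 v0 where x: "primitive W0 W1" "primitive W1 w2" "W0 0 = 0" "square_integrable v0"
    "x = (abs_L2 W0, abs_L2 v0)"
    using assms by (rule state_spaceE)
  note p = primitive_scale[OF x(1)] primitive_scale[OF x(2)]
  note sq = primitive_square_integrable[OF x(1)] primitive_square_integrable[OF x(2)]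
  have eq: "scale_state c x = (abs_L2 (\<lambda>s. c * W0 s), scale_L2 c (abs_L2 v0))" for c
    using sq by (simp add: x(5) scale_state_def scale_L2.abs_eq)
  show "scale_state c x \<in> state_space"
    unfolding eq by (rule state_spaceI[OF p]) (simp add: x)
  show "state_map a (scale_state (of_real r) x) = r *\<^sub>R state_map a x"
    unfolding eq state_map_primitive[OF p] unfolding x(5)
    using sq by (simp add: state_map_primitive[OF x(1,2)] scaleR_L2_def scale_L2.abs_eq[symmetric]
        scale_L2_scale_L2 mult.commute)
qed

lemma dom_TI:
  assumes "primitive W0 W1" "primitive W1 W2" "primitive W2 W3" "primitive W3 w4"
    and "primitive V0 V1" "primitive V1 v2"
    and "W0 0 = 0" "V0 0 = 0" "W2 0 = 0" "W2 1 = - of_real \<kappa> * V1 1" "W3 1 = of_real (\<gamma> - \<eta>\<^sup>2) * W1 1"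
  shows "(abs_L2 W0, abs_L2 V0) \<in> dom_T \<gamma> \<eta> \<kappa>"
  unfolding dom_T_def
  using assms sobolev_4I[OF assms(1-4)] sobolev_2I[OF assms(1,2)] sobolev_2I[OF assms(5,6)]
  by (simp add: state_space_def sobolev2_0_def primitive_value_at primitive_weak_deriv
      numeral_2_eq_2 numeral_3_eq_3)

lemma dom_TE:
  assumes "x \<in> dom_T \<gamma> \<eta> \<kappa>"
  obtains W0 W1 W2 W3 w4 V0 V1 v2 where
    "primitive W0 W1" "primitive W1 W2" "primitive W2 W3" "primitive W3 w4"
    "primitive V0 V1" "primitive V1 v2"
    "W0 0 = 0" "V0 0 = 0" "W2 0 = 0" "W2 1 = - of_real \<kappa> * V1 1" "W3 1 = of_real (\<gamma> - \<eta>\<^sup>2) * W1 1"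
    "x = (abs_L2 W0, abs_L2 V0)"
proof -
  obtain w v where x: "x = (w, v)" "w \<in> sobolev 4" "v \<in> sobolev 2" "value_at w 0 = 0" "value_at v 0 = 0"
    "value_at (weak_deriv (weak_deriv w)) 0 = 0"
    "value_at (weak_deriv (weak_deriv w)) 1 + of_real \<kappa> * value_at (weak_deriv v) 1 = 0"
    "value_at (weak_deriv (weak_deriv (weak_deriv w))) 1 - of_real (\<gamma> - \<eta>\<^sup>2) * value_at (weak_deriv w) 1 = 0"
    using assms by (auto simp: dom_T_def sobolev2_0_def numeral_2_eq_2 numeral_3_eq_3)
  obtain W0 W1 W2 W3 w4 where W: "primitive W0 W1" "primitive W1 W2" "primitive W2 W3" "primitive W3 w4"
    "w = abs_L2 W0"
    using sobolev_4E[OF x(2)] by metis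
  obtain V0 V1 v2 where V: "primitive V0 V1" "primitive V1 v2" "v = abs_L2 V0"
    using sobolev_2E[OF x(3)] by metis
  show thesis
    using x W V by (intro that[of W0 W1 W2 W3 w4 V0 V1 v2])
      (simp_all add: primitive_value_at primitive_weak_deriv add_eq_0_iff)
qed

lemma op_T_primitive:
  assumes "primitive W0 W1" "primitive W1 W2" "primitive W2 W3" "primitive W3 w4" "primitive V0 V1"
  shows "op_T \<beta> \<gamma> \<eta> (abs_L2 W0, abs_L2 V0) =
    (abs_L2 V0, - abs_L2 w4 + (\<gamma> - \<eta>\<^sup>2) *\<^sub>R abs_L2 W2 - (2 * \<beta> * \<eta>) *\<^sub>R abs_L2 V1)"
proof -
  have four: "4 = Suc (Suc (Suc (Suc 0)))"
    by simp
  show ?thesis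
    using assms unfolding op_T_def four
    by (simp add: primitive_weak_deriv numeral_2_eq_2 scaleR_L2_def)
qed

text \<open>A polynomial approximating w'' is integrated twice, starting from w'(0) and 0. The
  velocity is approximated before it, because the condition at 1 prescribes w''(1) through
  v'(1).\<close>

lemma state_space_dense:
  assumes x: "x \<in> state_space" and "e > 0" and a: "\<gamma> - \<eta>\<^sup>2 > 0"
  shows "\<exists>y\<in>dom_T \<gamma> \<eta> \<kappa>. norm (state_map (\<gamma> - \<eta>\<^sup>2) (x - y)) < e"
proof -
  define a where "a = \<gamma> - \<eta>\<^sup>2"
  have "a > 0" using a by (simp add: a_def)
  \<comment> \<open>The three components of the error contribute at most \<open>r\<close>,
    \<open>sqrt a * r\<close> and \<open>r\<close>.\<close>
  define r where "r = e / (2 + sqrt a)"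
  have "2 + sqrt a > 0"
    using \<open>a > 0\<close> by (simp add: add_pos_pos)
  then have "r > 0" "r * (2 + sqrt a) = e"
    using \<open>e > 0\<close> by (simp_all add: r_def)
  then have r: "r > 0" "r + (sqrt a * r + r) = e"
    by (simp_all add: algebra_simps)
  obtain W0 W1 w2 v0 where W: "primitive W0 W1" "primitive W1 w2" "W0 0 = 0" "square_integrable v0"
    "x = (abs_L2 W0, abs_L2 v0)"
    using x by (rule state_spaceE)
  obtain q where q: "polynomial_function q" "q 0 = 0" "norm (abs_L2 v0 - abs_L2 q) < r"
    using polynomial_function_dense_L2_boundary_values[OF W(4) r(1)] by metis
  obtain q' where q': "polynomial_function q'" "primitive q q'"
    using polynomial_function_primitive[OF q(1)] by metis
  obtain q'' where q'': "primitive q' q''"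
    using polynomial_function_primitive[OF q'(1)] by metis
  have w2: "square_integrable w2"
    using primitive_square_integrable[OF W(2)] by simp
  obtain p p' where p: "polynomial_function p" "polynomial_function p'"
    "\<And>s. (p has_vector_derivative p' s) (at s)"
    "p 0 = 0" "p 1 = - of_real \<kappa> * q' 1" "p' 1 = a *\<^sub>R (W1 0 + (LINT s|unit_interval. p s))"
    "norm (abs_L2 w2 - abs_L2 p) < r"
    using polynomial_function_dense_L2_boundary_slope[OF w2 r(1) \<open>a > 0\<close>] by metis
  have pp': "primitive p p'"
    using p by (intro primitive_of_derivative continuous_on_polymonial_function) auto
  obtain p'' where p'': "primitive p' p''"
    using polynomial_function_primitive[OF p(2)] by metis
  have sq_p: "square_integrable p"
    by (intro polynomial_function_square_integrable p)
  obtain P1 where P1: "primitive P1 p" "P1 0 = W1 0"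
    using primitive_exists[OF sq_p] by metis
  obtain P0 where P0: "primitive P0 P1" "P0 0 = 0"
    using primitive_exists[OF primitive_square_integrable(1)[OF P1(1)]] by metis
  have "P1 1 = W1 0 + (LINT s|unit_interval. p s)"
    using primitive_set_integral[OF P1(1), of 1] P1(2) by (simp add: set_lebesgue_integral_unit_interval)
  then have slope: "p' 1 = of_real (\<gamma> - \<eta>\<^sup>2) * P1 1"
    using p(6) by (simp add: a_def scaleR_conv_of_real)
  define y where "y = (abs_L2 P0, abs_L2 q)"
  have y: "y \<in> dom_T \<gamma> \<eta> \<kappa>"
    unfolding y_def by (rule dom_TI[OF P0(1) P1(1) pp' p'' q'(2) q'' P0(2) q(2) p(4) p(5) slope])
  have "y \<in> state_space"
    unfolding y_def by (rule state_spaceI[OF P0(1) P1(1) P0(2)])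
  then have "state_map a (x - y) = state_map a x - state_map a y"
    using x by (simp add: state_space_diff)
  also have "\<dots> = (abs_L2 w2 - abs_L2 p, sqrt a *\<^sub>R (abs_L2 W1 - abs_L2 P1), abs_L2 v0 - abs_L2 q)"
    unfolding W(5) y_def state_map_primitive[OF W(1,2)] state_map_primitive[OF P0(1) P1(1)]
    by (simp add: scaleR_diff_right)
  finally have eq: "state_map a (x - y) = \<dots>" .
  have "norm (abs_L2 (\<lambda>s. W1 s - P1 s)) \<le> norm (abs_L2 (\<lambda>s. w2 s - p s))"
    using P1(2) by (intro norm_primitive_le primitive_diff W P1(1)) simp
  then have W1: "norm (abs_L2 W1 - abs_L2 P1) \<le> norm (abs_L2 w2 - abs_L2 p)"
    using primitive_square_integrable[OF W(2)] primitive_square_integrable[OF P1(1)]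
    by (simp add: minus_L2.abs_eq)
  have "norm (state_map a (x - y)) \<le> norm (abs_L2 w2 - abs_L2 p)
      + (norm (sqrt a *\<^sub>R (abs_L2 W1 - abs_L2 P1)) + norm (abs_L2 v0 - abs_L2 q))"
    unfolding eq by (intro order_trans[OF norm_Pair_le] add_left_mono norm_Pair_le)
  also have "\<dots> \<le> norm (abs_L2 w2 - abs_L2 p)
      + (sqrt a * norm (abs_L2 w2 - abs_L2 p) + norm (abs_L2 v0 - abs_L2 q))"
    using W1 \<open>a > 0\<close> by (simp add: mult_left_mono)
  also have "\<dots> < r + (sqrt a * r + r)"
    using p(7) q(3) \<open>a > 0\<close> by (intro add_strict_mono mult_strict_left_mono) auto
  finally show ?thesis
    using y r(2) by (auto simp: a_def)
qed

section \<open>The energy identity and the multiplier estimate\<close>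

lemma primitive_mult_id_abs:
  assumes "primitive F f"
  shows "mult_id (abs_L2 F) = abs_L2 (\<lambda>s. of_real s * F s)"
    "abs_L2 F + mult_id (abs_L2 f) = abs_L2 (\<lambda>s. F s + of_real s * f s)"
  using primitive_square_integrable[OF assms]
  by (simp_all add: mult_id.abs_eq plus_L2.abs_eq square_integrable_mult_id)

text \<open>Half the time derivative of the squared norm. The terms
  \<open>a * inner (W1 1) (V0 1)\<close> cancel by the condition on \<open>W3 1\<close>, the
  condition on \<open>W2 1\<close> leaves the damping, and the gyroscopic term contributes
  \<open>b\<close> times the exact derivative of |v|^2, with v(0) = 0.\<close>

lemma energy_dissipation:
  assumes "primitive W0 W1" "primitive W1 W2" "primitive W2 W3" "primitive W3 w4"
    and "primitive V0 V1" "primitive V1 v2"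
    and "V0 0 = 0" "W2 0 = 0" "W2 1 = - of_real \<kappa> * V1 1" "W3 1 = of_real a * W1 1"
  shows "inner (abs_L2 v2) (abs_L2 W2) + a * inner (abs_L2 V1) (abs_L2 W1)
      + inner (- abs_L2 w4 + a *\<^sub>R abs_L2 W2 - (2 * b) *\<^sub>R abs_L2 V1) (abs_L2 V0)
    = - \<kappa> * (cmod (V1 1))\<^sup>2 - b * (cmod (V0 1))\<^sup>2"
proof -
  let ?i = "\<lambda>f g. inner (abs_L2 f) (abs_L2 g)"
  have "?i w4 V0 + ?i W3 V1 = a * inner (W1 1) (V0 1)"
    using primitive_integration_by_parts[OF assms(4,5)] assms by (simp flip: scaleR_conv_of_real)
  moreover have "?i W3 V1 + ?i W2 v2 = - \<kappa> * (cmod (V1 1))\<^sup>2"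
    using primitive_integration_by_parts[OF assms(3,6)] assms
    by (simp add: power2_norm_eq_inner flip: scaleR_conv_of_real)
  moreover have "a * (?i W2 V0 + ?i W1 V1) = a * inner (W1 1) (V0 1)"
    using primitive_integration_by_parts[OF assms(2,5)] assms by simp
  moreover have "(cmod (V0 1))\<^sup>2 = 2 * ?i V1 V0"
    using primitive_integration_by_parts[OF assms(5,5)] assms
    by (simp add: power2_norm_eq_inner inner_commute)
  ultimately show ?thesis
    by (simp add: inner_add_left inner_diff_left inner_commute[of "abs_L2 v2"]
        inner_commute[of "abs_L2 V1" "abs_L2 W1"] algebra_simps)
qed

text \<open>
  Testing the equation with the multiplier \<open>s w'\<close>. The gyroscopic term contributes the time
  derivative of \<open>\<beta> \<eta> \<integral> s |w'|\<^sup>2\<close>, which is why it cancels here.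
\<close>

lemma multiplier_estimate:
  assumes "primitive W0 W1" "primitive W1 W2" "primitive W2 W3" "primitive W3 w4"
    and "primitive V0 V1" "primitive V1 v2"
    and "V0 0 = 0" "W2 0 = 0" "W2 1 = - of_real \<kappa> * V1 1" "W3 1 = of_real a * W1 1" and "a > 0"
  shows "2 * b * inner (abs_L2 V1) (mult_id (abs_L2 W1))
      + inner (- abs_L2 w4 + a *\<^sub>R abs_L2 W2 - (2 * b) *\<^sub>R abs_L2 V1) (mult_id (abs_L2 W1))
      + inner (abs_L2 V0) (mult_id (abs_L2 V1))
    \<le> (cmod (V0 1))\<^sup>2 / 2 + (1 + 1 / a) / 2 * \<kappa>\<^sup>2 * (cmod (V1 1))\<^sup>2
      - ((norm (abs_L2 W2))\<^sup>2 + a * (norm (abs_L2 W1))\<^sup>2 + (norm (abs_L2 V0))\<^sup>2) / 2"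
proof -
  let ?i = "\<lambda>f g. inner (abs_L2 f) (abs_L2 g)"
  let ?s = "\<lambda>f g. inner (abs_L2 f) (mult_id (abs_L2 g))"
  have s_commute: "?s f g = ?s g f" for f g
    by (metis inner_commute inner_mult_id)
  have "W3 1 = a *\<^sub>R W1 1"
    using assms(10) by (simp add: scaleR_conv_of_real)
  then have 1: "?s w4 W1 + (?i W3 W1 + ?s W3 W2) = a * (cmod (W1 1))\<^sup>2"
    using primitive_integration_by_parts[OF assms(4) primitive_mult_id[OF assms(2)]]
    by (simp add: primitive_mult_id_abs[OF assms(2), symmetric] inner_add_right power2_norm_eq_inner)
  have 2: "?s W3 W2 + (?i W2 W2 + ?s W2 W3) = (cmod (W2 1))\<^sup>2"
    using primitive_integration_by_parts[OF assms(3) primitive_mult_id[OF assms(3)]]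
    by (simp add: primitive_mult_id_abs[OF assms(3), symmetric] inner_add_right power2_norm_eq_inner)
  have 3: "?i W3 W1 + ?i W2 W2 = inner (W2 1) (W1 1)"
    using primitive_integration_by_parts[OF assms(3,2)] assms(8) by simp
  have 4: "?s W2 W1 + (?i W1 W1 + ?s W1 W2) = (cmod (W1 1))\<^sup>2"
    using primitive_integration_by_parts[OF assms(2) primitive_mult_id[OF assms(2)]]
    by (simp add: primitive_mult_id_abs[OF assms(2), symmetric] inner_add_right power2_norm_eq_inner)
  have 5: "?s V1 V0 + (?i V0 V0 + ?s V0 V1) = (cmod (V0 1))\<^sup>2"
    using primitive_integration_by_parts[OF assms(5) primitive_mult_id[OF assms(5)]]
    by (simp add: primitive_mult_id_abs[OF assms(5), symmetric] inner_add_right power2_norm_eq_inner)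
  \<comment> \<open>The coefficient of |w'(1)|^2 is - a from identity 1 plus a / 2 from identity 4.
    The factor 3 / 2 collects 1 from identity 3 and 1 / 2 from identity 2; only 1 / 2 of it is kept
    at the end.\<close>
  have "- ?s w4 W1 + a * ?s W2 W1 + ?s V0 V1
      = (cmod (V0 1))\<^sup>2 / 2 + (cmod (W2 1))\<^sup>2 / 2 + inner (W2 1) (W1 1) - a / 2 * (cmod (W1 1))\<^sup>2
        - 3 / 2 * ?i W2 W2 - a / 2 * ?i W1 W1 - ?i V0 V0 / 2"
  proof -
    have "a * (2 * ?s W2 W1 + ?i W1 W1) = a * (cmod (W1 1))\<^sup>2"
      using 4 s_commute[of W1 W2] by simp
    then have "a * ?s W2 W1 = a / 2 * (cmod (W1 1))\<^sup>2 - a / 2 * ?i W1 W1"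
      by (simp add: field_simps)
    then show ?thesis
      using 1 2 3 5 s_commute[of V0 V1] s_commute[of W2 W3] by simp
  qed
  \<comment> \<open>Young's inequality, weighted so that the undamped slope term is absorbed
    exactly; the rest is a multiple of |w''(1)|^2 and hence of |v'(1)|^2.\<close>
  moreover have "inner (W2 1) (W1 1) \<le> a / 2 * (cmod (W1 1))\<^sup>2 + 1 / (2 * a) * (cmod (W2 1))\<^sup>2"
  proof -
    have "0 \<le> (a * cmod (W1 1) - cmod (W2 1))\<^sup>2 / (2 * a)"
      using \<open>a > 0\<close> by simp
    also have "\<dots> = a / 2 * (cmod (W1 1))\<^sup>2 + 1 / (2 * a) * (cmod (W2 1))\<^sup>2 - cmod (W2 1) * cmod (W1 1)"
      using \<open>a > 0\<close> by (simp add: power2_eq_square field_simps)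
    finally show ?thesis
      using norm_cauchy_schwarz[of "W2 1" "W1 1"] by linarith
  qed
  moreover have "(1 + 1 / a) / 2 * (\<kappa>\<^sup>2 * (cmod (V1 1))\<^sup>2) = (cmod (W2 1))\<^sup>2 / 2 + 1 / (2 * a) * (cmod (W2 1))\<^sup>2"
    using assms(9) by (simp add: norm_mult power_mult_distrib add_divide_distrib distrib_right)
  moreover have "?i W2 W2 \<ge> 0"
    by simp
  ultimately have "- ?s w4 W1 + a * ?s W2 W1 + ?s V0 V1
      \<le> (cmod (V0 1))\<^sup>2 / 2 + (1 + 1 / a) / 2 * (\<kappa>\<^sup>2 * (cmod (V1 1))\<^sup>2)
        - (?i W2 W2 + a * ?i W1 W1 + ?i V0 V0) / 2"
    unfolding add_divide_distrib by linarith
  then show ?thesis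
    by (simp add: inner_add_left inner_diff_left power2_norm_eq_inner mult.assoc)
qed

section \<open>The Lyapunov functional and its decay\<close>

lemma inner_abs_le_norm_product:
  "norm q \<le> k \<Longrightarrow> norm r \<le> l \<Longrightarrow> \<bar>inner q (r :: 'a :: real_inner)\<bar> \<le> k * l"
  by (meson Cauchy_Schwarz_ineq2 mult_mono norm_ge_zero order_trans)

text \<open>
  With \<open>P = lyapunov_op a b \<delta>\<close>, \<open>inner u (P u)\<close> is the Lyapunov functional
  $\|x\|^2 + \delta \int_0^1 (s\, v \overline{w'} + \beta\eta\, s |w'|^2)\,ds$, real part taken,
  at \<open>u = state_map a x\<close>, with \<open>b\<close> standing for $\beta\eta$.
\<close>

definition lyapunov_op :: "real \<Rightarrow> real \<Rightarrow> real \<Rightarrow> L2 \<times> L2 \<times> L2 \<Rightarrow> L2 \<times> L2 \<times> L2" where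
  "lyapunov_op a b \<delta> = (\<lambda>(p, q, v). (p, q + (\<delta> * b / a) *\<^sub>R mult_id q, v + (\<delta> / sqrt a) *\<^sub>R mult_id q))"

lemma bounded_linear_lyapunov_op: "bounded_linear (lyapunov_op a b \<delta>)"
proof -
  have "bounded_linear (\<lambda>u :: L2 \<times> L2 \<times> L2. (fst u, fst (snd u) + (\<delta> * b / a) *\<^sub>R mult_id (fst (snd u)),
      snd (snd u) + (\<delta> / sqrt a) *\<^sub>R mult_id (fst (snd u))))"
    by (intro bounded_linear_Pair bounded_linear_add bounded_linear_const_scaleR
        bounded_linear_compose[OF bounded_linear_mult_id] bounded_linear_fst
        bounded_linear_fst_comp bounded_linear_snd_comp bounded_linear_snd)
  then show ?thesis
    by (simp add: lyapunov_op_def case_prod_beta')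
qed

text \<open>Since the second component of a state is \<open>sqrt a\<close> times w', the factors
  \<open>b / a\<close> and \<open>1 / sqrt a\<close> undo this scaling. \<open>mult_id\<close> does
  not increase norms, so the perturbation costs at most
  \<open>\<delta> * (b / a + 1 / sqrt a)\<close> times the squared norm.\<close>

lemma lyapunov_op_near_identity:
  assumes "a > 0" "b \<ge> 0" "\<delta> \<ge> 0" "\<delta> * (b / a + 1 / sqrt a) \<le> 1 / 2"
  shows "\<bar>inner u (lyapunov_op a b \<delta> u) - (norm u)\<^sup>2\<bar> \<le> (norm u)\<^sup>2 / 2"
proof -
  obtain p q v where u: "u = (p, q, v)"
    by (cases u) auto
  have q: "norm q \<le> norm u" and v: "norm v \<le> norm u"
    unfolding u using norm_fst_le norm_snd_le order_trans by (metis fst_conv snd_conv)+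
  have Sq: "norm (mult_id q) \<le> norm u"
    using norm_mult_id_le q by (rule order_trans)
  have "inner u (lyapunov_op a b \<delta> u) - (norm u)\<^sup>2
      = \<delta> * (b / a) * inner q (mult_id q) + \<delta> * (1 / sqrt a) * inner v (mult_id q)"
    by (simp add: u lyapunov_op_def power2_norm_eq_inner inner_add_right)
  also have "\<bar>\<dots>\<bar> \<le> \<delta> * (b / a) * (norm u * norm u) + \<delta> * (1 / sqrt a) * (norm u * norm u)"
    using inner_abs_le_norm_product[OF q Sq] inner_abs_le_norm_product[OF v Sq] assms
    by (intro order_trans[OF abs_triangle_ineq] add_mono) (simp_all add: abs_mult mult_left_mono divide_right_mono)
  also have "\<dots> = \<delta> * (b / a + 1 / sqrt a) * (norm u)\<^sup>2"
    by (simp add: power2_eq_square algebra_simps)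
  also have "\<dots> \<le> 1 / 2 * (norm u)\<^sup>2"
    by (intro mult_right_mono assms) simp
  finally show ?thesis
    by simp
qed

text \<open>Twice the energy identity plus \<delta> times the multiplier estimate. The bounds on
  \<delta> say that the resulting coefficients of |v(1)|^2 and |v'(1)|^2 are nonpositive.\<close>

lemma lyapunov_decay:
  assumes x: "x \<in> dom_T \<gamma> \<eta> \<kappa>" and a: "a = \<gamma> - \<eta>\<^sup>2" "a > 0" and b: "b = \<beta> * \<eta>" and "\<kappa> > 0"
    and \<delta>: "\<delta> \<ge> 0" "\<delta> \<le> 4 * b" "\<delta> * ((1 + 1 / a) * \<kappa>) \<le> 4"
  shows "inner (state_map a (op_T \<beta> \<gamma> \<eta> x)) (lyapunov_op a b \<delta> (state_map a x))
      + inner (state_map a x) (lyapunov_op a b \<delta> (state_map a (op_T \<beta> \<gamma> \<eta> x)))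
    \<le> - (\<delta> / 2) * (norm (state_map a x))\<^sup>2"
proof -
  obtain W0 W1 W2 W3 w4 V0 V1 v2 where
    W: "primitive W0 W1" "primitive W1 W2" "primitive W2 W3" "primitive W3 w4"
    and V: "primitive V0 V1" "primitive V1 v2"
    and bc: "W0 0 = 0" "V0 0 = 0" "W2 0 = 0" "W2 1 = - of_real \<kappa> * V1 1" "W3 1 = of_real (\<gamma> - \<eta>\<^sup>2) * W1 1"
    and x_eq: "x = (abs_L2 W0, abs_L2 V0)"
    using x by (rule dom_TE)
  let ?i = "\<lambda>f g. inner (abs_L2 f) (abs_L2 g)"
  let ?s = "\<lambda>f g. inner (abs_L2 f) (mult_id (abs_L2 g))"
  define z where "z = - abs_L2 w4 + a *\<^sub>R abs_L2 W2 - (2 * b) *\<^sub>R abs_L2 V1"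
  define E where "E = (norm (abs_L2 W2))\<^sup>2 + a * (norm (abs_L2 W1))\<^sup>2 + (norm (abs_L2 V0))\<^sup>2"
  have s_commute: "?s f g = ?s g f" for f g
    by (metis inner_commute inner_mult_id)
  have J: "state_map a x = (abs_L2 W2, sqrt a *\<^sub>R abs_L2 W1, abs_L2 V0)"
    unfolding x_eq by (rule state_map_primitive[OF W(1,2)])
  have JT: "state_map a (op_T \<beta> \<gamma> \<eta> x) = (abs_L2 v2, sqrt a *\<^sub>R abs_L2 V1, z)"
    unfolding x_eq op_T_primitive[OF W V(1)] state_map_primitive[OF V] z_def
    by (simp add: a b mult.assoc)
  have S: "mult_id (r *\<^sub>R f) = r *\<^sub>R mult_id f" for r f
    by (simp add: scaleR_L2_def mult_id_scale)
  have norm_J: "(norm (state_map a x))\<^sup>2 = E"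
    using a(2) by (simp add: J E_def norm_Pair power_mult_distrib)
  have sqrt_a: "sqrt a * (sqrt a * y) = a * y" for y
    using a by (simp flip: mult.assoc)
  have energy: "?i v2 W2 + a * ?i V1 W1 + inner z (abs_L2 V0) = - \<kappa> * (cmod (V1 1))\<^sup>2 - b * (cmod (V0 1))\<^sup>2"
    unfolding z_def using energy_dissipation[OF W V bc(2-4)] bc(5) a by simp
  have multiplier: "2 * b * ?s V1 W1 + inner z (mult_id (abs_L2 W1)) + ?s V0 V1
      \<le> (cmod (V0 1))\<^sup>2 / 2 + (1 + 1 / a) / 2 * \<kappa>\<^sup>2 * (cmod (V1 1))\<^sup>2 - E / 2" (is "?m \<le> ?r")
    unfolding z_def E_def using multiplier_estimate[OF W V bc(2-4)] bc(5) a by simp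
  \<comment> \<open>Symmetry of \<open>mult_id\<close> merges the two derivatives of the weighted
    slope term into \<open>2 * b * ?s V1 W1\<close>, which cancels the gyroscopic contribution
    contained in \<open>z\<close>.\<close>
  have "inner (state_map a (op_T \<beta> \<gamma> \<eta> x)) (lyapunov_op a b \<delta> (state_map a x))
      + inner (state_map a x) (lyapunov_op a b \<delta> (state_map a (op_T \<beta> \<gamma> \<eta> x)))
    = 2 * (?i v2 W2 + a * ?i V1 W1 + inner z (abs_L2 V0)) + \<delta> * ?m"
  proof -
    have "sqrt a \<noteq> 0" "a \<noteq> 0"
      using a by auto
    then show ?thesis
      unfolding J JT lyapunov_op_def using s_commute[of W1 V1]
      by (simp add: S inner_add_right sqrt_a inner_commute[of "abs_L2 W2" "abs_L2 v2"]
          inner_commute[of "abs_L2 W1" "abs_L2 V1"] inner_commute[of "abs_L2 V0" z] algebra_simps)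
  qed
  also have "\<dots> \<le> 2 * (- \<kappa> * (cmod (V1 1))\<^sup>2 - b * (cmod (V0 1))\<^sup>2) + \<delta> * ?r"
    unfolding energy using multiplier \<delta>(1) by (intro add_left_mono mult_left_mono)
  also have "\<dots> = (\<delta> / 2 - 2 * b) * (cmod (V0 1))\<^sup>2
      + \<kappa> / 2 * (\<delta> * ((1 + 1 / a) * \<kappa>) - 4) * (cmod (V1 1))\<^sup>2 - \<delta> / 2 * E"
    by (simp add: power2_eq_square algebra_simps)
  also have "\<dots> \<le> 0 + 0 - \<delta> / 2 * E"
    using \<delta> \<open>\<kappa> > 0\<close> by (intro diff_right_mono add_mono mult_nonpos_nonneg mult_nonneg_nonpos) auto
  finally show ?thesis
    by (simp add: norm_J)
qed

theorem theorem5p2: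
  fixes \<beta> \<eta> \<kappa> \<gamma> :: real
    and U :: "real \<Rightarrow> L2 \<times> L2 \<Rightarrow> L2 \<times> L2"
  assumes "0 < \<beta>" and "\<beta> < 1" and "\<eta> > 0" and "\<kappa> > 0" and "\<gamma> > \<eta>\<^sup>2"
    and "generates state_space scale_state (norm_state \<gamma> \<eta>) (dom_T \<gamma> \<eta> \<kappa>) (op_T \<beta> \<gamma> \<eta>) U"
  shows "\<exists>\<epsilon>>0. \<exists>M\<ge>1. \<forall>t\<ge>0.
    operator_norm state_space (norm_state \<gamma> \<eta>) (U t) \<le> M * exp (- \<epsilon> * t)"
proof -
  define a b where "a = \<gamma> - \<eta>\<^sup>2" and "b = \<beta> * \<eta>"
  have pos: "a > 0" "b > 0"
    using assms by (simp_all add: a_def b_def)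
  have N: "norm_state \<gamma> \<eta> = (\<lambda>x. norm (state_map a x))"
    using assms by (intro ext) (simp add: norm_state_eq a_def)
  define c where "c = b / a + 1 / sqrt a"
  define d where "d = (1 + 1 / a) * \<kappa>"
  have cd: "c > 0" "d > 0"
    using pos \<open>\<kappa> > 0\<close> by (auto simp: c_def d_def intro!: add_pos_pos mult_pos_pos)
  \<comment> \<open>The first two bounds keep the boundary terms nonpositive; the third keeps the
    functional between 1/2 and 3/2 of the squared norm.\<close>
  define \<delta> where "\<delta> = min (4 * b) (min (4 / d) (1 / (2 * c)))"
  have "\<delta> > 0"
    using pos cd by (simp add: \<delta>_def)
  have \<delta>: "\<delta> \<le> 4 * b" "\<delta> \<le> 4 / d" "\<delta> \<le> 1 / (2 * c)"
    by (auto simp: \<delta>_def)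
  have \<delta>': "\<delta> * d \<le> 4" "\<delta> * c \<le> 1 / 2"
    using \<delta>(2,3) cd by (simp_all add: field_simps)
  interpret hilbert_semigroup state_space scale_state "state_map a" "dom_T \<gamma> \<eta> \<kappa>" "op_T \<beta> \<gamma> \<eta>" U
    by unfold_locales (use assms(6) in \<open>simp_all add: N state_space_diff state_space_scale\<close>)
  have near: "\<bar>inner u (lyapunov_op a b \<delta> u) - (norm u)\<^sup>2\<bar> \<le> (norm u)\<^sup>2 / 2" for u
    using pos \<open>\<delta> > 0\<close> \<delta>'(2) by (intro lyapunov_op_near_identity) (auto simp: c_def)
  \<comment> \<open>The constants are \<open>m = 1 / 2\<close>, \<open>M = 3 / 2\<close> and
    \<open>\<omega> = \<delta> / 2\<close>, which simplify to the factor \<open>sqrt 3\<close> and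
    the rate \<open>\<delta> / 6\<close>.\<close>
  have decay: "norm (state_map a (U t x))
      \<le> sqrt ((3 / 2) / (1 / 2)) * exp (- ((\<delta> / 2) / (2 * (3 / 2))) * t) * norm (state_map a x)"
    if "t \<ge> 0" "x \<in> state_space" for t x
  proof (rule lyapunov_exponential_decay[OF bounded_linear_lyapunov_op[of a b \<delta>] _ _ _ _ _ _ _ that])
    show "1 / 2 * (norm u)\<^sup>2 \<le> inner u (lyapunov_op a b \<delta> u)"
      and "inner u (lyapunov_op a b \<delta> u) \<le> 3 / 2 * (norm u)\<^sup>2" for u
      using near[of u] unfolding abs_le_iff by linarith+
    show "inner (state_map a (op_T \<beta> \<gamma> \<eta> x)) (lyapunov_op a b \<delta> (state_map a x))
        + inner (state_map a x) (lyapunov_op a b \<delta> (state_map a (op_T \<beta> \<gamma> \<eta> x)))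
      \<le> - (\<delta> / 2) * (norm (state_map a x))\<^sup>2" if "x \<in> dom_T \<gamma> \<eta> \<kappa>" for x
      using that a_def pos(1) b_def \<open>\<kappa> > 0\<close> less_imp_le[OF \<open>\<delta> > 0\<close>] \<delta>(1) \<delta>'(1)[unfolded d_def]
      by (rule lyapunov_decay)
    show "\<exists>y\<in>dom_T \<gamma> \<eta> \<kappa>. norm (state_map a (x - y)) < e" if "x \<in> state_space" "e > 0" for x e
      unfolding a_def using that pos(1)[unfolded a_def] by (rule state_space_dense)
  qed (use \<open>\<delta> > 0\<close> in auto)
  \<comment> \<open>The zero state shows that the supremum defining the operator norm runs over a
    nonempty set.\<close>
  have "primitive (\<lambda>s. 0) (\<lambda>s. 0)"
    by (simp add: primitive_def square_integrable_zero set_lebesgue_integral_def)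
  note state_spaceI[OF this this, of 0] state_map_primitive[OF this this, of a 0]
  then have zero: "0 \<in> state_space" "state_map a 0 = 0"
    by (simp_all add: zero_L2_def[symmetric] zero_prod_def)
  have "operator_norm state_space (norm_state \<gamma> \<eta>) (U t) \<le> sqrt 3 * exp (- (\<delta> / 6) * t)" if "t \<ge> 0" for t
    unfolding operator_norm_def N
  proof (rule cSUP_least)
    have "0 \<in> {x \<in> state_space. norm (state_map a x) \<le> 1}"
      using zero by simp
    then show "{x \<in> state_space. norm (state_map a x) \<le> 1} \<noteq> {}"
      by blast
    fix x assume x: "x \<in> {x \<in> state_space. norm (state_map a x) \<le> 1}"
    have "norm (state_map a (U t x)) \<le> sqrt 3 * exp (- (\<delta> / 6) * t) * norm (state_map a x)"
      using decay[OF that, of x] x by simp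
    also have "\<dots> \<le> sqrt 3 * exp (- (\<delta> / 6) * t) * 1"
      using x by (intro mult_left_mono) auto
    finally show "norm (state_map a (U t x)) \<le> sqrt 3 * exp (- (\<delta> / 6) * t)"
      by simp
  qed
  then show ?thesis
    using \<open>\<delta> > 0\<close> by (intro exI[of _ "\<delta> / 6"] conjI exI[of _ "sqrt 3"]) auto
qed

end
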